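(* Let $(T,\eta,\mu)$ be a monad on a category $\mathcal{C}$ and let $C$ be a colocalization on $\mathcal{C}$ with counit $c$. Let $U$ be the forgetful functor from the category $\mathcal{C}^T$ of $T$-algebras to $\mathcal{C}$. Then the following statements are equivalent: (a) $T$ preserves $C$-colocal objects. (b) For every $T$-algebra $(X,a)$ there is a $T$-algebra structure $\tilde a\colon TCX\to CX$ on $CX$ such that $c_X\colon (CX,\tilde a)\to (X,a)$ is a morphism of $T$-algebras, and if $g\colon (X,a)\to (Y,b)$ is any morphism of $T$-algebras then so is $Cg\colon (CX,\tilde a)\to (CY,\tilde b)$. (c) There is a colocalization $C^T$ on $\mathcal{C}^T$ with counit $c^T$ such that $CU=UC^T$ and $cU=Uc^T$. (d) There is a colocalization $C^T$ on $\mathcal{C}^T$ together with a natural isomorphism $CU\cong UC^T$. If these statements hold, then the $T$-algebra structures $\tilde a\colon TCX\to CX$ given in part (b) are unique, and the colocalization $C^T$ in (c) is also unique. Moreover, $U$ preserves and reflects colocal objects and equivalences.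
   Context: A colocalization on a category $\mathcal{C}$ is a functor $C=JK\colon\mathcal{C}\to\mathcal{C}$ where $J\colon\mathcal{S}\hookrightarrow\mathcal{C}$ is the inclusion of a full coreflective subcategory and $K$ is right adjoint to $J$; its counit $c\colon C\to\mathrm{Id}$ is the counit of this adjunction, and $(C,c)$ is an idempotent comonad. An object $X$ is $C$-colocal if $c_X\colon CX\to X$ is an isomorphism. A morphism $g$ is a $C$-equivalence if $Cg$ is an isomorphism. For a monad $(T,\eta,\mu)$ on $\mathcal{C}$, the category $\mathcal{C}^T$ is the Eilenberg--Moore category, whose objects are $T$-algebras $(X,a)$ with $a\colon TX\to X$, and $U(X,a)=X$. Given colocalizations $C_1$ on $\mathcal{C}_1$ and $C_2$ on $\mathcal{C}_2$, a functor $F\colon\mathcal{C}_1\to\mathcal{C}_2$ preserves (resp. reflects) colocal objects if $FX$ is $C_2$-colocal whenever $X$ is $C_1$-colocal (resp. $X$ is $C_1$-colocal whenever $FX$ is $C_2$-colocal), and it preserves (resp. reflects) equivalences if $Ff$ is a $C_2$-equivalence whenever $f$ is a $C_1$-equivalence (resp. $f$ is a $C_1$-equivalence whenever $Ff$ is a $C_2$-equivalence). For $U$ these notions refer to $C^T$ on $\mathcal{C}^T$ and $C$ on $\mathcal{C}$. *)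

theory Defs
  imports Main
begin

record ('o, 'm) cat =
  Obj :: "'o set"
  Arr :: "'m set"
  Dom :: "'m \<Rightarrow> 'o"
  Cod :: "'m \<Rightarrow> 'o"
  Ident :: "'o \<Rightarrow> 'm"
  Comp :: "'m \<Rightarrow> 'm \<Rightarrow> 'm"  (infixl "\<cdot>\<index>" 70)

definition hom :: "('o, 'm) cat \<Rightarrow> 'o \<Rightarrow> 'o \<Rightarrow> 'm set" where
  "hom A X Y = {f \<in> Arr A. Dom A f = X \<and> Cod A f = Y}"

locale category =
  fixes A :: "('o, 'm) cat" (structure)
  assumes Dom_in_Obj: "f \<in> Arr A \<Longrightarrow> Dom A f \<in> Obj A"
    and Cod_in_Obj: "f \<in> Arr A \<Longrightarrow> Cod A f \<in> Obj A"
    and Ident_in_hom: "X \<in> Obj A \<Longrightarrow> Ident A X \<in> hom A X X"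
    and Comp_in_hom: "f \<in> hom A X Y \<Longrightarrow> g \<in> hom A Y Z \<Longrightarrow> g \<cdot> f \<in> hom A X Z"
    and Comp_Ident: "f \<in> hom A X Y \<Longrightarrow> f \<cdot> Ident A X = f"
    and Ident_Comp: "f \<in> hom A X Y \<Longrightarrow> Ident A Y \<cdot> f = f"
    and Comp_assoc: "f \<in> hom A W X \<Longrightarrow> g \<in> hom A X Y \<Longrightarrow> h \<in> hom A Y Z \<Longrightarrow>
           (h \<cdot> g) \<cdot> f = h \<cdot> (g \<cdot> f)"

definition is_iso :: "('o, 'm) cat \<Rightarrow> 'm \<Rightarrow> bool" where
  "is_iso A f \<longleftrightarrow> f \<in> Arr A \<and>
     (\<exists>g \<in> hom A (Cod A f) (Dom A f).
        g \<cdot>\<^bsub>A\<^esub> f = Ident A (Dom A f) \<and> f \<cdot>\<^bsub>A\<^esub> g = Ident A (Cod A f))"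

definition full_subcat :: "('o, 'm) cat \<Rightarrow> 'o set \<Rightarrow> ('o, 'm) cat" where
  "full_subcat A S = A\<lparr>Obj := S, Arr := {f \<in> Arr A. Dom A f \<in> S \<and> Cod A f \<in> S}\<rparr>"

record ('o1, 'm1, 'o2, 'm2) ftr =
  fobj :: "'o1 \<Rightarrow> 'o2"
  farr :: "'m1 \<Rightarrow> 'm2"

locale is_functor = dom: category A + cod: category B
  for A :: "('o1, 'm1) cat" and B :: "('o2, 'm2) cat" and F :: "('o1, 'm1, 'o2, 'm2) ftr" +
  assumes fobj_in_Obj: "X \<in> Obj A \<Longrightarrow> fobj F X \<in> Obj B"
    and farr_in_hom: "f \<in> hom A X Y \<Longrightarrow> farr F f \<in> hom B (fobj F X) (fobj F Y)"
    and farr_Ident: "X \<in> Obj A \<Longrightarrow> farr F (Ident A X) = Ident B (fobj F X)"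
    and farr_Comp: "f \<in> hom A X Y \<Longrightarrow> g \<in> hom A Y Z \<Longrightarrow>
           farr F (g \<cdot>\<^bsub>A\<^esub> f) = farr F g \<cdot>\<^bsub>B\<^esub> farr F f"

text \<open>The underlying HOL functions are unconstrained outside the source category, so equality of
  functors and of natural transformations is equality on its objects and arrows.\<close>

definition functor_eq ::
  "('o1, 'm1) cat \<Rightarrow> ('o1, 'm1, 'o2, 'm2) ftr \<Rightarrow> ('o1, 'm1, 'o2, 'm2) ftr \<Rightarrow> bool" where
  "functor_eq A F G \<longleftrightarrow>
     (\<forall>X \<in> Obj A. fobj F X = fobj G X) \<and> (\<forall>f \<in> Arr A. farr F f = farr G f)"

definition trans_eq :: "('o1, 'm1) cat \<Rightarrow> ('o1 \<Rightarrow> 'm2) \<Rightarrow> ('o1 \<Rightarrow> 'm2) \<Rightarrow> bool" where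
  "trans_eq A s t \<longleftrightarrow> (\<forall>X \<in> Obj A. s X = t X)"

text \<open>Also serves as the inclusion of a full subcategory, whose objects and arrows have the same
  types as those of the ambient category.\<close>

definition id_ftr :: "('o, 'm, 'o, 'm) ftr" where
  "id_ftr = \<lparr>fobj = id, farr = id\<rparr>"

definition comp_ftr ::
  "('o2, 'm2, 'o3, 'm3) ftr \<Rightarrow> ('o1, 'm1, 'o2, 'm2) ftr \<Rightarrow> ('o1, 'm1, 'o3, 'm3) ftr"
  (infixl "\<circ>\<^sub>F" 55) where
  "G \<circ>\<^sub>F F = \<lparr>fobj = fobj G \<circ> fobj F, farr = farr G \<circ> farr F\<rparr>"

text \<open>A natural transformation is given by its components. Thus \<open>t \<circ> fobj H\<close> is the
  whiskering of \<open>t\<close> with a functor \<open>H\<close> applied first, and \<open>farr H \<circ> t\<close> is the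
  whiskering with \<open>H\<close> applied afterwards.\<close>

locale nat_trans = source: is_functor A B F + target: is_functor A B G
  for A :: "('o1, 'm1) cat" and B :: "('o2, 'm2) cat"
    and F G :: "('o1, 'm1, 'o2, 'm2) ftr" and t :: "'o1 \<Rightarrow> 'm2" +
  assumes component_in_hom: "X \<in> Obj A \<Longrightarrow> t X \<in> hom B (fobj F X) (fobj G X)"
    and naturality: "f \<in> hom A X Y \<Longrightarrow> t Y \<cdot>\<^bsub>B\<^esub> farr F f = farr G f \<cdot>\<^bsub>B\<^esub> t X"

locale nat_iso = nat_trans A B F G t
  for A :: "('o1, 'm1) cat" and B :: "('o2, 'm2) cat"
    and F G :: "('o1, 'm1, 'o2, 'm2) ftr" and t :: "'o1 \<Rightarrow> 'm2" +
  assumes component_iso: "X \<in> Obj A \<Longrightarrow> is_iso B (t X)"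

locale adjunction = left: is_functor A B F + right: is_functor B A G
    + unit: nat_trans A A id_ftr "G \<circ>\<^sub>F F" u + counit: nat_trans B B "F \<circ>\<^sub>F G" id_ftr e
  for A :: "('o1, 'm1) cat" and B :: "('o2, 'm2) cat"
    and F :: "('o1, 'm1, 'o2, 'm2) ftr" and G :: "('o2, 'm2, 'o1, 'm1) ftr"
    and u :: "'o1 \<Rightarrow> 'm1" and e :: "'o2 \<Rightarrow> 'm2" +
  assumes triangle_left: "X \<in> Obj A \<Longrightarrow>
            e (fobj F X) \<cdot>\<^bsub>B\<^esub> farr F (u X) = Ident B (fobj F X)"
    and triangle_right: "Y \<in> Obj B \<Longrightarrow>
            farr G (e Y) \<cdot>\<^bsub>A\<^esub> u (fobj G Y) = Ident A (fobj G Y)"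

text \<open>The subcategory need not be closed under isomorphism, so it is not determined by the
  functor \<open>C\<close> and the counit \<open>c\<close>; a colocalization is the pair \<open>(C, c)\<close>.\<close>

definition colocalization ::
  "('o, 'm) cat \<Rightarrow> ('o, 'm, 'o, 'm) ftr \<Rightarrow> ('o \<Rightarrow> 'm) \<Rightarrow> bool" where
  "colocalization A C c \<longleftrightarrow>
     (\<exists>S K u. S \<subseteq> Obj A \<and> adjunction (full_subcat A S) A id_ftr K u c \<and>
        functor_eq A C (id_ftr \<circ>\<^sub>F K))"

definition colocal :: "('o, 'm) cat \<Rightarrow> ('o \<Rightarrow> 'm) \<Rightarrow> 'o \<Rightarrow> bool" where
  "colocal A c X \<longleftrightarrow> X \<in> Obj A \<and> is_iso A (c X)"

definition equivalence :: "('o, 'm) cat \<Rightarrow> ('o, 'm, 'o, 'm) ftr \<Rightarrow> 'm \<Rightarrow> bool" where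
  "equivalence A C g \<longleftrightarrow> g \<in> Arr A \<and> is_iso A (farr C g)"

definition preserves_colocal ::
  "('o1, 'm1) cat \<Rightarrow> ('o1 \<Rightarrow> 'm1) \<Rightarrow> ('o2, 'm2) cat \<Rightarrow> ('o2 \<Rightarrow> 'm2) \<Rightarrow>
     ('o1, 'm1, 'o2, 'm2) ftr \<Rightarrow> bool" where
  "preserves_colocal A1 c1 A2 c2 F \<longleftrightarrow>
     (\<forall>X \<in> Obj A1. colocal A1 c1 X \<longrightarrow> colocal A2 c2 (fobj F X))"

definition reflects_colocal ::
  "('o1, 'm1) cat \<Rightarrow> ('o1 \<Rightarrow> 'm1) \<Rightarrow> ('o2, 'm2) cat \<Rightarrow> ('o2 \<Rightarrow> 'm2) \<Rightarrow>
     ('o1, 'm1, 'o2, 'm2) ftr \<Rightarrow> bool" where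
  "reflects_colocal A1 c1 A2 c2 F \<longleftrightarrow>
     (\<forall>X \<in> Obj A1. colocal A2 c2 (fobj F X) \<longrightarrow> colocal A1 c1 X)"

definition preserves_equivalences ::
  "('o1, 'm1) cat \<Rightarrow> ('o1, 'm1, 'o1, 'm1) ftr \<Rightarrow>
     ('o2, 'm2) cat \<Rightarrow> ('o2, 'm2, 'o2, 'm2) ftr \<Rightarrow> ('o1, 'm1, 'o2, 'm2) ftr \<Rightarrow> bool" where
  "preserves_equivalences A1 C1 A2 C2 F \<longleftrightarrow>
     (\<forall>f \<in> Arr A1. equivalence A1 C1 f \<longrightarrow> equivalence A2 C2 (farr F f))"

definition reflects_equivalences ::
  "('o1, 'm1) cat \<Rightarrow> ('o1, 'm1, 'o1, 'm1) ftr \<Rightarrow>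
     ('o2, 'm2) cat \<Rightarrow> ('o2, 'm2, 'o2, 'm2) ftr \<Rightarrow> ('o1, 'm1, 'o2, 'm2) ftr \<Rightarrow> bool" where
  "reflects_equivalences A1 C1 A2 C2 F \<longleftrightarrow>
     (\<forall>f \<in> Arr A1. equivalence A2 C2 (farr F f) \<longrightarrow> equivalence A1 C1 f)"

locale monad = endo: is_functor A A T + unit: nat_trans A A id_ftr T \<eta>
    + mult: nat_trans A A "T \<circ>\<^sub>F T" T \<mu>
  for A :: "('o, 'm) cat" and T :: "('o, 'm, 'o, 'm) ftr" and \<eta> \<mu> :: "'o \<Rightarrow> 'm" +
  assumes unit_left: "X \<in> Obj A \<Longrightarrow> \<mu> X \<cdot>\<^bsub>A\<^esub> \<eta> (fobj T X) = Ident A (fobj T X)"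
    and unit_right: "X \<in> Obj A \<Longrightarrow> \<mu> X \<cdot>\<^bsub>A\<^esub> farr T (\<eta> X) = Ident A (fobj T X)"
    and mult_assoc: "X \<in> Obj A \<Longrightarrow> \<mu> X \<cdot>\<^bsub>A\<^esub> farr T (\<mu> X) = \<mu> X \<cdot>\<^bsub>A\<^esub> \<mu> (fobj T X)"

definition algebras ::
  "('o, 'm) cat \<Rightarrow> ('o, 'm, 'o, 'm) ftr \<Rightarrow> ('o \<Rightarrow> 'm) \<Rightarrow> ('o \<Rightarrow> 'm) \<Rightarrow> ('o \<times> 'm) set" where
  "algebras A T \<eta> \<mu> = {(X, a). X \<in> Obj A \<and> a \<in> hom A (fobj T X) X \<and>
     a \<cdot>\<^bsub>A\<^esub> \<eta> X = Ident A X \<and> a \<cdot>\<^bsub>A\<^esub> farr T a = a \<cdot>\<^bsub>A\<^esub> \<mu> X}"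

definition alg_hom ::
  "('o, 'm) cat \<Rightarrow> ('o, 'm, 'o, 'm) ftr \<Rightarrow> 'o \<times> 'm \<Rightarrow> 'o \<times> 'm \<Rightarrow> 'm set" where
  "alg_hom A T P Q =
     {g \<in> hom A (fst P) (fst Q). g \<cdot>\<^bsub>A\<^esub> snd P = snd Q \<cdot>\<^bsub>A\<^esub> farr T g}"

text \<open>One morphism of \<open>A\<close> can underlie morphisms between different algebras, so an arrow of the
  Eilenberg--Moore category is stored together with its source and its target.\<close>

definition EM ::
  "('o, 'm) cat \<Rightarrow> ('o, 'm, 'o, 'm) ftr \<Rightarrow> ('o \<Rightarrow> 'm) \<Rightarrow> ('o \<Rightarrow> 'm) \<Rightarrow>
     ('o \<times> 'm, ('o \<times> 'm) \<times> 'm \<times> ('o \<times> 'm)) cat" where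
  "EM A T \<eta> \<mu> =
     \<lparr>Obj = algebras A T \<eta> \<mu>,
      Arr = {(P, g, Q). P \<in> algebras A T \<eta> \<mu> \<and> Q \<in> algebras A T \<eta> \<mu> \<and> g \<in> alg_hom A T P Q},
      Dom = (\<lambda>(P, g, Q). P),
      Cod = (\<lambda>(P, g, Q). Q),
      Ident = (\<lambda>P. (P, Ident A (fst P), P)),
      Comp = (\<lambda>(Q', h, R) (P, g, Q). (P, h \<cdot>\<^bsub>A\<^esub> g, R))\<rparr>"

definition forget :: "('o \<times> 'm, ('o \<times> 'm) \<times> 'm \<times> ('o \<times> 'm), 'o, 'm) ftr" where
  "forget = \<lparr>fobj = fst, farr = (\<lambda>(P, g, Q). g)\<rparr>"

definition strict_lift ::
  "('o, 'm) cat \<Rightarrow> ('o, 'm, 'o, 'm) ftr \<Rightarrow> ('o \<Rightarrow> 'm) \<Rightarrow> ('o \<Rightarrow> 'm) \<Rightarrow>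
     ('o, 'm, 'o, 'm) ftr \<Rightarrow> ('o \<Rightarrow> 'm) \<Rightarrow>
     ('o \<times> 'm, ('o \<times> 'm) \<times> 'm \<times> ('o \<times> 'm), 'o \<times> 'm, ('o \<times> 'm) \<times> 'm \<times> ('o \<times> 'm)) ftr \<Rightarrow>
     ('o \<times> 'm \<Rightarrow> ('o \<times> 'm) \<times> 'm \<times> ('o \<times> 'm)) \<Rightarrow> bool" where
  "strict_lift A T \<eta> \<mu> C c CT cT \<longleftrightarrow>
     colocalization (EM A T \<eta> \<mu>) CT cT \<and>
     functor_eq (EM A T \<eta> \<mu>) (C \<circ>\<^sub>F forget) (forget \<circ>\<^sub>F CT) \<and>
     trans_eq (EM A T \<eta> \<mu>) (c \<circ> fobj forget) (farr forget \<circ> cT)"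

definition iso_lift ::
  "('o, 'm) cat \<Rightarrow> ('o, 'm, 'o, 'm) ftr \<Rightarrow> ('o \<Rightarrow> 'm) \<Rightarrow> ('o \<Rightarrow> 'm) \<Rightarrow>
     ('o, 'm, 'o, 'm) ftr \<Rightarrow>
     ('o \<times> 'm, ('o \<times> 'm) \<times> 'm \<times> ('o \<times> 'm), 'o \<times> 'm, ('o \<times> 'm) \<times> 'm \<times> ('o \<times> 'm)) ftr \<Rightarrow>
     ('o \<times> 'm \<Rightarrow> ('o \<times> 'm) \<times> 'm \<times> ('o \<times> 'm)) \<Rightarrow> bool" where
  "iso_lift A T \<eta> \<mu> C CT cT \<longleftrightarrow>
     colocalization (EM A T \<eta> \<mu>) CT cT \<and>
     (\<exists>t. nat_iso (EM A T \<eta> \<mu>) A (C \<circ>\<^sub>F forget) (forget \<circ>\<^sub>F CT) t)"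

end

theory Submission
  imports Defs
begin

text \<open>A colocalization is the same as a comonad \<open>(C, c)\<close> with \<open>Cc = cC\<close> invertible, so every map
  from a colocal object to \<open>X\<close> factors uniquely through \<open>c\<close> at \<open>X\<close>. If \<open>T\<close> preserves colocal objects,
  this universal property lets one factor \<open>a \<circ> Tc : TCX \<rightarrow> X\<close> through \<open>CX\<close>, and all the required
  identities hold because they hold after composing with \<open>c\<close>. Conversely, suppose that \<open>c\<close> at \<open>TX\<close>
  factors through an algebra map \<open>k\<close> from an algebra \<open>Z\<close> with colocal carrier to the free algebra \<open>TX\<close>.
  If \<open>X\<close> is colocal, then the unit \<open>X \<rightarrow> TX\<close> factors through \<open>k\<close>; extending the factor to an algebra map
  \<open>TX \<rightarrow> Z\<close> gives a section of \<open>k\<close>, so \<open>TX\<close> is a retract of a colocal object.\<close>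

section \<open>Isomorphisms, full subcategories and functors\<close>

lemma comp_ftr_simps [simp]:
  "fobj (G \<circ>\<^sub>F F) X = fobj G (fobj F X)"
  "farr (G \<circ>\<^sub>F F) f = farr G (farr F f)"
  by (simp_all add: comp_ftr_def)

lemma id_ftr_simps [simp]:
  "fobj id_ftr X = X"
  "farr id_ftr f = f"
  by (simp_all add: id_ftr_def)

context category
begin

lemma Comp_seq:
  assumes "f \<in> Arr A" "g \<in> Arr A" "Dom A g = Cod A f"
  shows "g \<cdot> f \<in> Arr A" "Dom A (g \<cdot> f) = Dom A f" "Cod A (g \<cdot> f) = Cod A g"
  using assms Comp_in_hom [of f "Dom A f" "Cod A f" g "Cod A g"] by (auto simp: hom_def)

lemma Comp_assoc_seq:
  assumes "f \<in> Arr A" "g \<in> Arr A" "h \<in> Arr A" "Dom A g = Cod A f" "Dom A h = Cod A g"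
  shows "(h \<cdot> g) \<cdot> f = h \<cdot> (g \<cdot> f)"
  using assms Comp_assoc [of f "Dom A f" "Cod A f" g "Cod A g" h "Cod A h"]
  by (auto simp: hom_def)

lemma hom_Obj:
  assumes "f \<in> hom A X Y"
  shows "X \<in> Obj A" "Y \<in> Obj A"
  using assms Dom_in_Obj Cod_in_Obj by (auto simp: hom_def)

lemma is_isoI:
  assumes "f \<in> hom A X Y" "g \<in> hom A Y X" "g \<cdot> f = Ident A X" "f \<cdot> g = Ident A Y"
  shows "is_iso A f"
  using assms by (auto simp: is_iso_def hom_def)

lemma is_isoE:
  assumes "is_iso A f" "f \<in> hom A X Y"
  obtains g where "g \<in> hom A Y X" "g \<cdot> f = Ident A X" "f \<cdot> g = Ident A Y" "is_iso A g"
  using assms by (auto simp: is_iso_def hom_def)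

lemma is_iso_Ident:
  assumes "X \<in> Obj A"
  shows "is_iso A (Ident A X)"
  using assms is_isoI Ident_in_hom Comp_Ident by blast

lemma iso_cancel_left:
  assumes "is_iso A g" "g \<in> hom A X Y" "f \<in> hom A W X" "f' \<in> hom A W X" "g \<cdot> f = g \<cdot> f'"
  shows "f = f'"
proof -
  obtain k where k: "k \<in> hom A Y X" "k \<cdot> g = Ident A X" using assms(1,2) is_isoE by blast
  have "f = (k \<cdot> g) \<cdot> f" using k assms(3) Ident_Comp by simp
  also have "\<dots> = (k \<cdot> g) \<cdot> f'" using k assms Comp_assoc by metis
  also have "\<dots> = f'" using k assms(4) Ident_Comp by simp
  finally show ?thesis .
qed

lemma iso_cancel_right:
  assumes "is_iso A g" "g \<in> hom A X Y" "f \<in> hom A Y Z" "f' \<in> hom A Y Z" "f \<cdot> g = f' \<cdot> g"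
  shows "f = f'"
proof -
  obtain k where k: "k \<in> hom A Y X" "g \<cdot> k = Ident A Y" using assms(1,2) is_isoE by blast
  have "f = f \<cdot> (g \<cdot> k)" using k assms(3) Comp_Ident by simp
  also have "\<dots> = f' \<cdot> (g \<cdot> k)" using k assms Comp_assoc by metis
  also have "\<dots> = f'" using k assms(4) Comp_Ident by simp
  finally show ?thesis .
qed

lemma is_iso_Comp:
  assumes "is_iso A f" "f \<in> hom A X Y" "is_iso A g" "g \<in> hom A Y Z"
  shows "is_iso A (g \<cdot> f)"
proof -
  obtain f' where f': "f' \<in> hom A Y X" "f' \<cdot> f = Ident A X" "f \<cdot> f' = Ident A Y"
    using assms(1,2) is_isoE by blast
  obtain g' where g': "g' \<in> hom A Z Y" "g' \<cdot> g = Ident A Y" "g \<cdot> g' = Ident A Z"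
    using assms(3,4) is_isoE by blast
  have gf: "g \<cdot> f \<in> hom A X Z" using assms Comp_in_hom by blast
  have "(f' \<cdot> g') \<cdot> (g \<cdot> f) = f' \<cdot> ((g' \<cdot> g) \<cdot> f)"
    using Comp_assoc [OF gf g'(1) f'(1)] Comp_assoc [OF assms(2,4) g'(1)] by simp
  also have "\<dots> = Ident A X" using f' g' assms(2) Ident_Comp by simp
  finally have 1: "(f' \<cdot> g') \<cdot> (g \<cdot> f) = Ident A X" .
  have fg: "f' \<cdot> g' \<in> hom A Z X" using f' g' Comp_in_hom by blast
  have "(g \<cdot> f) \<cdot> (f' \<cdot> g') = g \<cdot> ((f \<cdot> f') \<cdot> g')"
    using Comp_assoc [OF fg assms(2,4)] Comp_assoc [OF g'(1) f'(1) assms(2)] by simp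
  also have "\<dots> = Ident A Z" using f' g' Ident_Comp by simp
  finally show ?thesis using is_isoI [OF gf fg 1] by blast
qed

lemma is_iso_right_factor:
  assumes "is_iso A g" "g \<in> hom A Y Z" "f \<in> hom A X Y" "is_iso A (g \<cdot> f)"
  shows "is_iso A f"
proof -
  obtain g' where g': "g' \<in> hom A Z Y" "g' \<cdot> g = Ident A Y" "is_iso A g'"
    using assms(1,2) is_isoE by blast
  have "g' \<cdot> (g \<cdot> f) = f"
    using Comp_assoc [OF assms(3,2) g'(1)] g' assms(3) Ident_Comp by simp
  then show ?thesis
    using is_iso_Comp [OF assms(4) Comp_in_hom [OF assms(3,2)] g'(3,1)] by simp
qed

lemma is_iso_left_factor:
  assumes "is_iso A f" "f \<in> hom A X Y" "g \<in> hom A Y Z" "is_iso A (g \<cdot> f)"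
  shows "is_iso A g"
proof -
  obtain f' where f': "f' \<in> hom A Y X" "f \<cdot> f' = Ident A Y" "is_iso A f'"
    using assms(1,2) is_isoE by blast
  have "(g \<cdot> f) \<cdot> f' = g"
    using Comp_assoc [OF f'(1) assms(2,3)] f' assms(3) Comp_Ident by simp
  then show ?thesis
    using is_iso_Comp [OF f'(3,1) assms(4) Comp_in_hom [OF assms(2,3)]] by simp
qed

lemma full_subcat_category:
  assumes "S \<subseteq> Obj A"
  shows "category (full_subcat A S)"
proof
  show "h \<cdot>\<^bsub>full_subcat A S\<^esub> g \<cdot>\<^bsub>full_subcat A S\<^esub> f = h \<cdot>\<^bsub>full_subcat A S\<^esub> (g \<cdot>\<^bsub>full_subcat A S\<^esub> f)"
    if "f \<in> hom (full_subcat A S) W X" "g \<in> hom (full_subcat A S) X Y"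
      "h \<in> hom (full_subcat A S) Y Z" for f g h W X Y Z
    using that Comp_assoc_seq by (auto simp: full_subcat_def hom_def)
qed (use assms Comp_seq Ident_in_hom Comp_Ident Ident_Comp in
    \<open>auto simp: full_subcat_def hom_def subset_iff\<close>)

lemma id_ftr_functor: "is_functor A A id_ftr"
  by unfold_locales (auto simp: id_ftr_def)

end

lemma full_subcat_hom:
  "f \<in> hom (full_subcat A S) X Y \<longleftrightarrow> f \<in> hom A X Y \<and> X \<in> S \<and> Y \<in> S"
  by (auto simp: full_subcat_def hom_def)

lemma (in is_functor) farr_iso:
  assumes "is_iso A f" "f \<in> hom A X Y"
  shows "is_iso B (farr F f)"
proof -
  obtain g where g: "g \<in> hom A Y X" "g \<cdot>\<^bsub>A\<^esub> f = Ident A X" "f \<cdot>\<^bsub>A\<^esub> g = Ident A Y"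
    using dom.is_isoE [OF assms] by blast
  show ?thesis
  proof (rule cod.is_isoI)
    show "farr F g \<cdot>\<^bsub>B\<^esub> farr F f = Ident B (fobj F X)"
      using farr_Comp [OF assms(2) g(1)] g farr_Ident dom.hom_Obj assms(2) by metis
    show "farr F f \<cdot>\<^bsub>B\<^esub> farr F g = Ident B (fobj F Y)"
      using farr_Comp [OF g(1) assms(2)] g farr_Ident dom.hom_Obj assms(2) by metis
  qed (use assms g farr_in_hom in blast)+
qed

lemma comp_ftr_functor:
  assumes "is_functor A B F" "is_functor B D G"
  shows "is_functor A D (G \<circ>\<^sub>F F)"
proof -
  interpret F: is_functor A B F by fact
  interpret G: is_functor B D G by fact
  show ?thesis
  proof
    show "farr (G \<circ>\<^sub>F F) (g \<cdot>\<^bsub>A\<^esub> f) = farr (G \<circ>\<^sub>F F) g \<cdot>\<^bsub>D\<^esub> farr (G \<circ>\<^sub>F F) f"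
      if "f \<in> hom A X Y" "g \<in> hom A Y Z" for f g X Y Z
      using that by (simp add: comp_ftr_def F.farr_Comp G.farr_Comp [OF F.farr_in_hom F.farr_in_hom])
  qed (simp_all add: comp_ftr_def F.fobj_in_Obj G.fobj_in_Obj F.farr_in_hom G.farr_in_hom
      F.farr_Ident G.farr_Ident)
qed

subsection \<open>Colocalizations as idempotent comonads\<close>

text \<open>The comultiplication stays implicit as the inverse of \<open>c (fobj C X)\<close>. With
  that choice the axiom \<open>C_counit\<close> expresses the remaining counit law.\<close>

locale idempotent_comonad = category A + nat_trans A A C id_ftr c
  for A :: "('o, 'm) cat" (structure) and C c +
  assumes iso_counit_C: "X \<in> Obj A \<Longrightarrow> is_iso A (c (fobj C X))"
    and C_counit: "X \<in> Obj A \<Longrightarrow> farr C (c X) = c (fobj C X)"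
begin

lemma c_in_hom: "X \<in> Obj A \<Longrightarrow> c X \<in> hom A (fobj C X) X"
  using component_in_hom by (simp add: id_ftr_def)

lemma c_natural: "f \<in> hom A X Y \<Longrightarrow> c Y \<cdot> farr C f = f \<cdot> c X"
  using naturality by (simp add: id_ftr_def)

lemma colocal_C: "X \<in> Obj A \<Longrightarrow> colocal A c (fobj C X)"
  using iso_counit_C source.fobj_in_Obj by (auto simp: colocal_def)

text \<open>Uniqueness half of the universal property of \<open>c X\<close>. Applying
  \<open>C\<close> to the equation and rewriting \<open>farr C (c X)\<close> as
  \<open>c (fobj C X)\<close> allows naturality of \<open>c\<close> to turn it into
  \<open>g \<cdot> c Y = h \<cdot> c Y\<close>, where the isomorphism \<open>c Y\<close>
  cancels.\<close>

lemma counit_mono: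
  assumes "colocal A c Y" "X \<in> Obj A" "g \<in> hom A Y (fobj C X)" "h \<in> hom A Y (fobj C X)"
    and "c X \<cdot> g = c X \<cdot> h"
  shows "g = h"
proof -
  have cY: "is_iso A (c Y)" "c Y \<in> hom A (fobj C Y) Y"
    using assms(1) c_in_hom by (auto simp: colocal_def)
  have "farr C (c X) \<cdot> farr C g = farr C (c X) \<cdot> farr C h"
    using assms source.farr_Comp c_in_hom by metis
  then have "c (fobj C X) \<cdot> farr C g = c (fobj C X) \<cdot> farr C h"
    using assms(2) C_counit by simp
  then have "g \<cdot> c Y = h \<cdot> c Y" using c_natural assms(3,4) by simp
  then show ?thesis using iso_cancel_right cY assms(3,4) by blast
qed

text \<open>Existence half of the universal property: the factor is \<open>farr C f\<close> after
  the inverse of \<open>c Y\<close>, and naturality of \<open>c\<close> at \<open>f\<close> gives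
  the triangle.\<close>

lemma counit_factor:
  assumes "colocal A c Y" "f \<in> hom A Y X"
  obtains g where "g \<in> hom A Y (fobj C X)" "c X \<cdot> g = f"
proof -
  have cY: "is_iso A (c Y)" "c Y \<in> hom A (fobj C Y) Y"
    using assms(1) c_in_hom by (auto simp: colocal_def)
  then obtain k where k: "k \<in> hom A Y (fobj C Y)" "c Y \<cdot> k = Ident A Y"
    using is_isoE by metis
  have Cf: "farr C f \<in> hom A (fobj C Y) (fobj C X)" using assms(2) source.farr_in_hom by blast
  have X: "X \<in> Obj A" using assms(2) hom_Obj by blast
  have "c X \<cdot> (farr C f \<cdot> k) = (f \<cdot> c Y) \<cdot> k"
    using Comp_assoc [OF k(1) Cf c_in_hom [OF X]] c_natural [OF assms(2)] by simp
  also have "\<dots> = f" using Comp_assoc [OF k(1) cY(2) assms(2)] k(2) Comp_Ident assms(2) by simp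
  finally show ?thesis using that Comp_in_hom k(1) Cf by blast
qed

text \<open>The inverse of \<open>c Y\<close> is \<open>farr C r \<cdot> (k \<cdot> i)\<close> with
  \<open>k\<close> inverse to \<open>c Z\<close>. Naturality of \<open>c\<close> at \<open>i\<close>
  settles one composite, naturality at \<open>r\<close> the other.\<close>

lemma colocal_retract:
  assumes "colocal A c Z" "r \<in> hom A Z Y" "i \<in> hom A Y Z" "r \<cdot> i = Ident A Y"
  shows "colocal A c Y"
proof -
  have cZ: "is_iso A (c Z)" "c Z \<in> hom A (fobj C Z) Z"
    using assms(1) c_in_hom by (auto simp: colocal_def)
  then obtain k where k: "k \<in> hom A Z (fobj C Z)" "k \<cdot> c Z = Ident A (fobj C Z)"
      "c Z \<cdot> k = Ident A Z"
    using is_isoE by metis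
  have Y: "Y \<in> Obj A" using assms(2) hom_Obj by blast
  have homs: "farr C r \<in> hom A (fobj C Z) (fobj C Y)" "farr C i \<in> hom A (fobj C Y) (fobj C Z)"
    "c Y \<in> hom A (fobj C Y) Y"
    using assms source.farr_in_hom c_in_hom Y by auto
  have ki: "k \<cdot> i \<in> hom A Y (fobj C Z)" using k assms Comp_in_hom by blast
  have "is_iso A (c Y)"
  proof (rule is_isoI)
    have "(farr C r \<cdot> (k \<cdot> i)) \<cdot> c Y = farr C r \<cdot> (k \<cdot> (i \<cdot> c Y))"
      using Comp_assoc [OF homs(3) ki homs(1)] Comp_assoc [OF homs(3) assms(3) k(1)] by simp
    also have "\<dots> = farr C r \<cdot> ((k \<cdot> c Z) \<cdot> farr C i)"
      using Comp_assoc [OF homs(2) cZ(2) k(1)] c_natural [OF assms(3)] by simp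
    also have "\<dots> = farr C (r \<cdot> i)"
      using k(2) homs(2) Ident_Comp source.farr_Comp [OF assms(3,2)] by simp
    also have "\<dots> = Ident A (fobj C Y)" using assms(4) Y source.farr_Ident by simp
    finally show "(farr C r \<cdot> (k \<cdot> i)) \<cdot> c Y = Ident A (fobj C Y)" .
    have "c Y \<cdot> (farr C r \<cdot> (k \<cdot> i)) = (r \<cdot> c Z) \<cdot> (k \<cdot> i)"
      using Comp_assoc [OF ki homs(1,3)] c_natural [OF assms(2)] by simp
    also have "\<dots> = r \<cdot> ((c Z \<cdot> k) \<cdot> i)"
      using Comp_assoc [OF ki cZ(2) assms(2)] Comp_assoc [OF assms(3) k(1) cZ(2)] by simp
    also have "\<dots> = Ident A Y" using k(3) assms(3,4) Ident_Comp by simp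
    finally show "c Y \<cdot> (farr C r \<cdot> (k \<cdot> i)) = Ident A Y" .
  qed (use homs ki Comp_in_hom in blast)+
  then show ?thesis using Y by (simp add: colocal_def)
qed

end

text \<open>The adjunction unit \<open>u\<close> turns out to be inverse to \<open>c\<close> on
  \<open>S\<close>, and every value of \<open>K\<close> lies in \<open>S\<close>. The remaining work
  transports this from \<open>K\<close> to \<open>C\<close>, which agrees with \<open>K\<close> on
  objects and arrows of \<open>A\<close>.\<close>

lemma colocalization_idempotent_comonad:
  assumes "colocalization A C c"
  shows "idempotent_comonad A C c"
proof -
  obtain S K u where S: "S \<subseteq> Obj A" and adj: "adjunction (full_subcat A S) A id_ftr K u c"
    and eq: "functor_eq A C (id_ftr \<circ>\<^sub>F K)"
    using assms by (auto simp: colocalization_def)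
  interpret A: category A using adj unfolding adjunction_def is_functor_def by blast
  interpret adjunction "full_subcat A S" A id_ftr K u c by fact
  have C_obj: "fobj C X = fobj K X" if "X \<in> Obj A" for X
    using eq that by (simp add: functor_eq_def comp_ftr_def id_ftr_def)
  have C_arr: "farr C f = farr K f" if "f \<in> hom A X Y" for f X Y
    using eq that by (simp add: functor_eq_def comp_ftr_def id_ftr_def hom_def)
  have K_obj: "fobj K X \<in> S" if "X \<in> Obj A" for X
    using right.fobj_in_Obj [OF that] by (simp add: full_subcat_def)
  have K_arr: "farr K f \<in> hom A (fobj K X) (fobj K Y)" if "f \<in> hom A X Y" for f X Y
    using right.farr_in_hom [OF that] by (simp add: full_subcat_hom)
  have c_hom: "c X \<in> hom A (fobj K X) X" if "X \<in> Obj A" for X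
    using counit.component_in_hom [OF that] by (simp add: comp_ftr_def id_ftr_def)
  have c_nat: "c Y \<cdot>\<^bsub>A\<^esub> farr K f = f \<cdot>\<^bsub>A\<^esub> c X" if "f \<in> hom A X Y" for f X Y
    using counit.naturality [OF that] by (simp add: comp_ftr_def id_ftr_def)
  have u_hom: "u X \<in> hom A X (fobj K X)" if "X \<in> S" for X
    using unit.component_in_hom [of X] that
    by (simp add: comp_ftr_def id_ftr_def full_subcat_hom) (simp add: full_subcat_def)
  have u_nat: "u Y \<cdot>\<^bsub>A\<^esub> f = farr K f \<cdot>\<^bsub>A\<^esub> u X" if "f \<in> hom A X Y" "X \<in> S" "Y \<in> S" for f X Y
    using unit.naturality [of f X Y] that
    by (simp add: comp_ftr_def id_ftr_def full_subcat_hom) (simp add: full_subcat_def)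
  have tri_left: "c X \<cdot>\<^bsub>A\<^esub> u X = Ident A X" if "X \<in> S" for X
    using triangle_left [of X] that by (simp add: id_ftr_def full_subcat_def)
  have tri_right: "farr K (c X) \<cdot>\<^bsub>A\<^esub> u (fobj K X) = Ident A (fobj K X)" if "X \<in> Obj A" for X
    using triangle_right [OF that] by (simp add: full_subcat_def)
  \<comment> \<open>Naturality of \<open>u\<close> at \<open>c X\<close> rewrites the left side as
    \<open>farr K (c X) \<cdot> u (fobj K X)\<close>, which the right triangle identity
    evaluates.\<close>
  have u_c: "u X \<cdot>\<^bsub>A\<^esub> c X = Ident A (fobj K X)" if "X \<in> S" for X
    using u_nat [OF c_hom] tri_right K_obj that S by (metis subsetD)
  have iso: "is_iso A (c X)" if "X \<in> S" for X
    using A.is_isoI [OF c_hom u_hom u_c tri_left] that S by blast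
  \<comment> \<open>Both sides are left inverses of the isomorphism \<open>u (fobj K X)\<close>: the
    first by the right triangle identity, the second by the left one.\<close>
  have K_c: "farr K (c X) = c (fobj K X)" if X: "X \<in> Obj A" for X
  proof (rule A.iso_cancel_right)
    have KX: "fobj K X \<in> S" using K_obj X .
    then have "is_iso A (u (fobj K X))"
      using A.is_isoI [OF u_hom c_hom tri_left u_c] S by blast
    then show "is_iso A (u (fobj K X))" .
    show "u (fobj K X) \<in> hom A (fobj K X) (fobj K (fobj K X))" using u_hom KX .
    show "farr K (c X) \<in> hom A (fobj K (fobj K X)) (fobj K X)" using K_arr c_hom X by blast
    show "c (fobj K X) \<in> hom A (fobj K (fobj K X)) (fobj K X)" using c_hom KX S by blast
    show "farr K (c X) \<cdot>\<^bsub>A\<^esub> u (fobj K X) = c (fobj K X) \<cdot>\<^bsub>A\<^esub> u (fobj K X)"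
      using tri_right X tri_left KX by simp
  qed
  have "is_functor A A C"
  proof
    show "fobj C X \<in> Obj A" if "X \<in> Obj A" for X using that C_obj K_obj S by auto
    show "farr C f \<in> hom A (fobj C X) (fobj C Y)" if "f \<in> hom A X Y" for f X Y
      using that C_obj C_arr K_arr A.hom_Obj by metis
    show "farr C (Ident A X) = Ident A (fobj C X)" if "X \<in> Obj A" for X
      using right.farr_Ident [OF that] C_arr [OF A.Ident_in_hom [OF that]] C_obj [OF that]
      by (simp add: full_subcat_def)
    show "farr C (g \<cdot>\<^bsub>A\<^esub> f) = farr C g \<cdot>\<^bsub>A\<^esub> farr C f" if "f \<in> hom A X Y" "g \<in> hom A Y Z" for f g X Y Z
      using right.farr_Comp [OF that] C_arr A.Comp_in_hom that
      by (simp add: full_subcat_def C_arr [OF A.Comp_in_hom [OF that]])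
  qed
  then interpret C: is_functor A A C .
  interpret I: is_functor A A id_ftr by (rule A.id_ftr_functor)
  show ?thesis
  proof
    show "c X \<in> hom A (fobj C X) (fobj id_ftr X)" if "X \<in> Obj A" for X
      using that c_hom C_obj by (simp add: id_ftr_def)
    show "c Y \<cdot>\<^bsub>A\<^esub> farr C f = farr id_ftr f \<cdot>\<^bsub>A\<^esub> c X" if "f \<in> hom A X Y" for f X Y
      using that c_nat C_arr by (simp add: id_ftr_def)
    show "is_iso A (c (fobj C X))" if "X \<in> Obj A" for X using that iso C_obj K_obj by simp
    show "farr C (c X) = c (fobj C X)" if "X \<in> Obj A" for X
      using that K_c C_obj C_arr c_hom by metis
  qed
qed

text \<open>Since \<open>c\<close> is invertible on colocal objects, its inverse can serve as the
  unit of an adjunction whose counit is \<open>c\<close>. Both triangle identities then say that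
  \<open>u\<close> and \<open>c\<close> are mutually inverse, the right one after rewriting by
  \<open>C_counit\<close>.\<close>

lemma (in idempotent_comonad) colocalization: "colocalization A C c"
proof -
  \<comment> \<open>Among the full subcategories that present the colocalization, this choice
    consists of all colocal objects, so it is closed under isomorphism.\<close>
  define S where "S = {X. colocal A c X}"
  have S: "S \<subseteq> Obj A" by (auto simp: S_def colocal_def)
  have "\<exists>k. k \<in> hom A X (fobj C X) \<and> k \<cdot> c X = Ident A (fobj C X) \<and> c X \<cdot> k = Ident A X"
    if "X \<in> S" for X
    using that is_isoE [OF _ c_in_hom] unfolding S_def colocal_def by blast
  then obtain u where u: "u X \<in> hom A X (fobj C X)" "u X \<cdot> c X = Ident A (fobj C X)"
    "c X \<cdot> u X = Ident A X" if "X \<in> S" for X by metis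
  have CS: "fobj C X \<in> S" if "X \<in> Obj A" for X using that colocal_C by (simp add: S_def)
  have obj: "X \<in> Obj (full_subcat A S) \<longleftrightarrow> X \<in> S" for X by (simp add: full_subcat_def)
  have str: "Comp (full_subcat A S) = Comp A" "Ident (full_subcat A S) = Ident A"
    by (simp_all add: full_subcat_def)
  interpret S: category "full_subcat A S" using full_subcat_category S .
  interpret inc: is_functor "full_subcat A S" A id_ftr
    by unfold_locales (use S in \<open>auto simp: obj str full_subcat_hom\<close>)
  \<comment> \<open>The right adjoint is \<open>C\<close> itself with its target restricted to
    \<open>S\<close>.\<close>
  interpret K: is_functor A "full_subcat A S" C
    by unfold_locales
      (use CS hom_Obj source.farr_in_hom source.farr_Ident source.farr_Comp in
        \<open>auto simp: obj str full_subcat_hom\<close>)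
  have "adjunction (full_subcat A S) A id_ftr C u c"
  proof -
    interpret KI: is_functor "full_subcat A S" "full_subcat A S" "C \<circ>\<^sub>F id_ftr"
      using comp_ftr_functor [OF inc.is_functor_axioms K.is_functor_axioms] .
    interpret IK: is_functor A A "id_ftr \<circ>\<^sub>F C"
      using comp_ftr_functor [OF K.is_functor_axioms inc.is_functor_axioms] .
    interpret IS: is_functor "full_subcat A S" "full_subcat A S" id_ftr
      by (rule S.id_ftr_functor)
    show ?thesis
    proof
      show "u X \<in> hom (full_subcat A S) (fobj id_ftr X) (fobj (C \<circ>\<^sub>F id_ftr) X)"
        if "X \<in> Obj (full_subcat A S)" for X
        using that u CS S by (auto simp: obj full_subcat_hom)
      show "u Y \<cdot>\<^bsub>full_subcat A S\<^esub> farr id_ftr f =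
          farr (C \<circ>\<^sub>F id_ftr) f \<cdot>\<^bsub>full_subcat A S\<^esub> u X"
        if "f \<in> hom (full_subcat A S) X Y" for f X Y
      proof -
        have f: "f \<in> hom A X Y" "X \<in> S" "Y \<in> S" using that by (auto simp: full_subcat_hom)
        have XY: "X \<in> Obj A" "Y \<in> Obj A" using f S by auto
        have Cf: "farr C f \<in> hom A (fobj C X) (fobj C Y)" using f source.farr_in_hom by blast
        \<comment> \<open>Both sides of the naturality square of \<open>u\<close> are maps from the
          colocal object \<open>X\<close> to \<open>fobj C Y\<close>, so by
          \<open>counit_mono\<close> it suffices to compare them after \<open>c Y\<close>.\<close>
        have "c Y \<cdot> (u Y \<cdot> f) = (c Y \<cdot> u Y) \<cdot> f"
          using Comp_assoc [OF f(1) u(1) c_in_hom] f XY by simp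
        also have "\<dots> = f \<cdot> (c X \<cdot> u X)"
          using u f Ident_Comp Comp_Ident by simp
        also have "\<dots> = (c Y \<cdot> farr C f) \<cdot> u X"
          using Comp_assoc [OF u(1) c_in_hom f(1)] c_natural [OF f(1)] f XY by simp
        also have "\<dots> = c Y \<cdot> (farr C f \<cdot> u X)"
          using Comp_assoc [OF u(1) Cf c_in_hom] f XY by simp
        finally have "u Y \<cdot> f = farr C f \<cdot> u X"
          using counit_mono [of X Y] f XY Comp_in_hom [OF f(1) u(1)] Comp_in_hom [OF u(1) Cf]
          by (simp add: S_def)
        then show ?thesis by (simp add: str)
      qed
      show "c X \<in> hom A (fobj (id_ftr \<circ>\<^sub>F C) X) (fobj id_ftr X)" if "X \<in> Obj A" for X
        using that c_in_hom by simp
      show "c Y \<cdot> farr (id_ftr \<circ>\<^sub>F C) f = farr id_ftr f \<cdot> c X" if "f \<in> hom A X Y" for f X Y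
        using that c_natural by simp
      show "c (fobj id_ftr X) \<cdot> farr id_ftr (u X) = Ident A (fobj id_ftr X)"
        if "X \<in> Obj (full_subcat A S)" for X
        using that u by (simp add: obj)
      show "farr C (c X) \<cdot>\<^bsub>full_subcat A S\<^esub> u (fobj C X) = Ident (full_subcat A S) (fobj C X)"
        if "X \<in> Obj A" for X
        using that u CS C_counit by (simp add: str)
    qed
  qed
  moreover have "functor_eq A C (id_ftr \<circ>\<^sub>F C)" by (simp add: functor_eq_def)
  ultimately show ?thesis
    unfolding colocalization_def by (intro exI conjI) (rule S)
qed

subsection \<open>Eilenberg--Moore categories and free algebras\<close>

lemma algebrasD:
  assumes "P \<in> algebras A T \<eta> \<mu>"
  shows "fst P \<in> Obj A" "snd P \<in> hom A (fobj T (fst P)) (fst P)"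
    and "snd P \<cdot>\<^bsub>A\<^esub> \<eta> (fst P) = Ident A (fst P)"
    and "snd P \<cdot>\<^bsub>A\<^esub> farr T (snd P) = snd P \<cdot>\<^bsub>A\<^esub> \<mu> (fst P)"
  using assms by (auto simp: algebras_def)

lemma alg_homD:
  assumes "g \<in> alg_hom A T P Q"
  shows "g \<in> hom A (fst P) (fst Q)" "g \<cdot>\<^bsub>A\<^esub> snd P = snd Q \<cdot>\<^bsub>A\<^esub> farr T g"
  using assms by (auto simp: alg_hom_def)

lemma EM_hom:
  "f \<in> hom (EM A T \<eta> \<mu>) P Q \<longleftrightarrow> (\<exists>g. f = (P, g, Q) \<and>
     P \<in> algebras A T \<eta> \<mu> \<and> Q \<in> algebras A T \<eta> \<mu> \<and> g \<in> alg_hom A T P Q)"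
  by (auto simp: EM_def hom_def)

lemma EM_simps [simp]:
  "Obj (EM A T \<eta> \<mu>) = algebras A T \<eta> \<mu>"
  "Ident (EM A T \<eta> \<mu>) P = (P, Ident A (fst P), P)"
  "(Q', h, R) \<cdot>\<^bsub>EM A T \<eta> \<mu>\<^esub> (P, g, Q) = (P, h \<cdot>\<^bsub>A\<^esub> g, R)"
  "Dom (EM A T \<eta> \<mu>) (P, g, Q) = P"
  "Cod (EM A T \<eta> \<mu>) (P, g, Q) = Q"
  by (simp_all add: EM_def)

lemma forget_simps [simp]:
  "fobj forget P = fst P"
  "farr forget (P, g, Q) = g"
  by (simp_all add: forget_def)

context monad
begin

lemma T_in_hom: "f \<in> hom A X Y \<Longrightarrow> farr T f \<in> hom A (fobj T X) (fobj T Y)"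
  by (rule endo.farr_in_hom)

lemma unit_in_hom: "X \<in> Obj A \<Longrightarrow> \<eta> X \<in> hom A X (fobj T X)"
  using unit.component_in_hom by simp

lemma mult_in_hom: "X \<in> Obj A \<Longrightarrow> \<mu> X \<in> hom A (fobj T (fobj T X)) (fobj T X)"
  using mult.component_in_hom by simp

lemma unit_natural: "f \<in> hom A X Y \<Longrightarrow> \<eta> Y \<cdot>\<^bsub>A\<^esub> f = farr T f \<cdot>\<^bsub>A\<^esub> \<eta> X"
  using unit.naturality by simp

lemma mult_natural:
  "f \<in> hom A X Y \<Longrightarrow> \<mu> Y \<cdot>\<^bsub>A\<^esub> farr T (farr T f) = farr T f \<cdot>\<^bsub>A\<^esub> \<mu> X"
  using mult.naturality by simp

lemma alg_hom_Ident:
  assumes "P \<in> algebras A T \<eta> \<mu>"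
  shows "Ident A (fst P) \<in> alg_hom A T P P"
  using algebrasD [OF assms] endo.farr_Ident endo.dom.Ident_in_hom
    endo.dom.Ident_Comp endo.dom.Comp_Ident
  by (simp add: alg_hom_def)

lemma alg_hom_Comp:
  assumes "g \<in> alg_hom A T P Q" "h \<in> alg_hom A T Q R"
    and "P \<in> algebras A T \<eta> \<mu>" "Q \<in> algebras A T \<eta> \<mu>" "R \<in> algebras A T \<eta> \<mu>"
  shows "h \<cdot>\<^bsub>A\<^esub> g \<in> alg_hom A T P R"
proof -
  note g = alg_homD [OF assms(1)] and h = alg_homD [OF assms(2)]
  note a = algebrasD(2) [OF assms(3)] and b = algebrasD(2) [OF assms(4)]
    and d = algebrasD(2) [OF assms(5)]
  have "(h \<cdot>\<^bsub>A\<^esub> g) \<cdot>\<^bsub>A\<^esub> snd P = h \<cdot>\<^bsub>A\<^esub> (snd Q \<cdot>\<^bsub>A\<^esub> farr T g)"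
    using endo.dom.Comp_assoc [OF a g(1) h(1)] g(2) by simp
  also have "\<dots> = (snd R \<cdot>\<^bsub>A\<^esub> farr T h) \<cdot>\<^bsub>A\<^esub> farr T g"
    using endo.dom.Comp_assoc [OF T_in_hom [OF g(1)] b h(1)] h(2) by simp
  also have "\<dots> = snd R \<cdot>\<^bsub>A\<^esub> farr T (h \<cdot>\<^bsub>A\<^esub> g)"
    using endo.dom.Comp_assoc [OF T_in_hom [OF g(1)] T_in_hom [OF h(1)] d]
      endo.farr_Comp [OF g(1) h(1)] by simp
  finally show ?thesis
    using endo.dom.Comp_in_hom [OF g(1) h(1)] by (simp add: alg_hom_def)
qed

lemma EM_category: "category (EM A T \<eta> \<mu>)"
proof
  show "f \<cdot>\<^bsub>EM A T \<eta> \<mu>\<^esub> Ident (EM A T \<eta> \<mu>) P = f"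
    if "f \<in> hom (EM A T \<eta> \<mu>) P Q" for f P Q
    using that endo.dom.Comp_Ident by (auto simp: EM_hom alg_hom_def)
  show "Ident (EM A T \<eta> \<mu>) Q \<cdot>\<^bsub>EM A T \<eta> \<mu>\<^esub> f = f"
    if "f \<in> hom (EM A T \<eta> \<mu>) P Q" for f P Q
    using that endo.dom.Ident_Comp by (auto simp: EM_hom alg_hom_def)
  show "(h \<cdot>\<^bsub>EM A T \<eta> \<mu>\<^esub> g) \<cdot>\<^bsub>EM A T \<eta> \<mu>\<^esub> f = h \<cdot>\<^bsub>EM A T \<eta> \<mu>\<^esub> (g \<cdot>\<^bsub>EM A T \<eta> \<mu>\<^esub> f)"
    if "f \<in> hom (EM A T \<eta> \<mu>) P Q" "g \<in> hom (EM A T \<eta> \<mu>) Q R" "h \<in> hom (EM A T \<eta> \<mu>) R S"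
    for f g h P Q R S
    using that endo.dom.Comp_assoc by (auto simp: EM_hom dest!: alg_homD(1))
  show "g \<cdot>\<^bsub>EM A T \<eta> \<mu>\<^esub> f \<in> hom (EM A T \<eta> \<mu>) P R"
    if "f \<in> hom (EM A T \<eta> \<mu>) P Q" "g \<in> hom (EM A T \<eta> \<mu>) Q R" for f g P Q R
    using that by (auto simp: EM_hom intro: alg_hom_Comp)
  show "Ident (EM A T \<eta> \<mu>) P \<in> hom (EM A T \<eta> \<mu>) P P" if "P \<in> Obj (EM A T \<eta> \<mu>)" for P
    using that alg_hom_Ident by (simp add: EM_hom)
qed (auto simp: EM_def)

lemma forget_functor: "is_functor (EM A T \<eta> \<mu>) A forget"
proof -
  interpret EM: category "EM A T \<eta> \<mu>" by (rule EM_category)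
  show ?thesis
    by unfold_locales (auto simp: EM_hom dest: alg_homD algebrasD)
qed

text \<open>Conjugating the algebra map equation of \<open>g\<close> by an inverse of
  \<open>g\<close> in \<open>A\<close> shows that this inverse is again an algebra map.\<close>

lemma forget_reflects_iso:
  assumes "(P, g, Q) \<in> Arr (EM A T \<eta> \<mu>)" "is_iso A g"
  shows "is_iso (EM A T \<eta> \<mu>) (P, g, Q)"
proof -
  interpret EM: category "EM A T \<eta> \<mu>" by (rule EM_category)
  have P: "P \<in> algebras A T \<eta> \<mu>" and Q: "Q \<in> algebras A T \<eta> \<mu>" and "g \<in> alg_hom A T P Q"
    using assms(1) by (auto simp: EM_def)
  note g = alg_homD [OF this(3)]
  obtain k where k: "k \<in> hom A (fst Q) (fst P)" "k \<cdot>\<^bsub>A\<^esub> g = Ident A (fst P)"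
    "g \<cdot>\<^bsub>A\<^esub> k = Ident A (fst Q)" "is_iso A k"
    using endo.dom.is_isoE [OF assms(2) g(1)] by blast
  note a = algebrasD [OF P] and b = algebrasD [OF Q]
  have Tg: "farr T g \<in> hom A (fobj T (fst P)) (fobj T (fst Q))"
    and Tk: "farr T k \<in> hom A (fobj T (fst Q)) (fobj T (fst P))"
    using g k T_in_hom by blast+
  \<comment> \<open>The structure map of \<open>Q\<close> is the conjugate of that of
    \<open>P\<close>: it equals \<open>g\<close> after \<open>snd P\<close> after
    \<open>farr T k\<close>. Composing with \<open>k\<close> on the left then cancels
    \<open>g\<close>.\<close>
  have "snd Q = snd Q \<cdot>\<^bsub>A\<^esub> (farr T g \<cdot>\<^bsub>A\<^esub> farr T k)"
    using endo.farr_Comp [OF k(1) g(1)] k(3) endo.farr_Ident [OF b(1)]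
      endo.dom.Comp_Ident [OF b(2)] by simp
  also have "\<dots> = (g \<cdot>\<^bsub>A\<^esub> snd P) \<cdot>\<^bsub>A\<^esub> farr T k"
    using endo.dom.Comp_assoc [OF Tk Tg b(2)] g(2) by simp
  also have "\<dots> = g \<cdot>\<^bsub>A\<^esub> (snd P \<cdot>\<^bsub>A\<^esub> farr T k)"
    using endo.dom.Comp_assoc [OF Tk a(2) g(1)] .
  finally have "k \<cdot>\<^bsub>A\<^esub> snd Q = (k \<cdot>\<^bsub>A\<^esub> g) \<cdot>\<^bsub>A\<^esub> (snd P \<cdot>\<^bsub>A\<^esub> farr T k)"
    using endo.dom.Comp_assoc [OF endo.dom.Comp_in_hom [OF Tk a(2)] g(1) k(1)] by simp
  also have "\<dots> = snd P \<cdot>\<^bsub>A\<^esub> farr T k"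
    using k(2) endo.dom.Ident_Comp [OF endo.dom.Comp_in_hom [OF Tk a(2)]] by simp
  finally have "k \<in> alg_hom A T Q P" using k(1) by (simp add: alg_hom_def)
  then show ?thesis
    using EM.is_isoI [of "(P, g, Q)" P Q "(Q, k, P)"] P Q \<open>g \<in> alg_hom A T P Q\<close> k
    by (simp add: EM_hom)
qed

lemma is_iso_EM_iff:
  assumes "f \<in> Arr (EM A T \<eta> \<mu>)"
  shows "is_iso (EM A T \<eta> \<mu>) f \<longleftrightarrow> is_iso A (farr forget f)"
proof
  interpret U: is_functor "EM A T \<eta> \<mu>" A forget by (rule forget_functor)
  show "is_iso A (farr forget f)" if "is_iso (EM A T \<eta> \<mu>) f"
    using U.farr_iso [OF that] assms by (auto simp: hom_def)
  show "is_iso (EM A T \<eta> \<mu>) f" if "is_iso A (farr forget f)"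
    using that assms forget_reflects_iso by (cases f) auto
qed

lemma free_algebra:
  assumes "X \<in> Obj A"
  shows "(fobj T X, \<mu> X) \<in> algebras A T \<eta> \<mu>"
  using assms endo.fobj_in_Obj mult_in_hom unit_left mult_assoc by (simp add: algebras_def)

text \<open>Existence half of the universal property of the free algebra on \<open>X\<close>. The
  algebra map equation comes from naturality of \<open>\<mu>\<close> and associativity of
  \<open>Q\<close>; the restriction along \<open>\<eta> X\<close> comes from naturality of
  \<open>\<eta>\<close> and the unit law of \<open>Q\<close>.\<close>

lemma free_extension:
  assumes Q: "Q \<in> algebras A T \<eta> \<mu>" and e: "e \<in> hom A X (fst Q)"
  shows "snd Q \<cdot>\<^bsub>A\<^esub> farr T e \<in> alg_hom A T (fobj T X, \<mu> X) Q"
    and "(snd Q \<cdot>\<^bsub>A\<^esub> farr T e) \<cdot>\<^bsub>A\<^esub> \<eta> X = e"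
proof -
  note q = algebrasD [OF Q]
  have X: "X \<in> Obj A" using e endo.dom.hom_Obj by blast
  note Te = T_in_hom [OF e] and TTe = T_in_hom [OF T_in_hom [OF e]] and Tq = T_in_hom [OF q(2)]
  have "(snd Q \<cdot>\<^bsub>A\<^esub> farr T e) \<cdot>\<^bsub>A\<^esub> \<mu> X = snd Q \<cdot>\<^bsub>A\<^esub> (\<mu> (fst Q) \<cdot>\<^bsub>A\<^esub> farr T (farr T e))"
    using endo.dom.Comp_assoc [OF mult_in_hom [OF X] Te q(2)] mult_natural [OF e] by simp
  also have "\<dots> = (snd Q \<cdot>\<^bsub>A\<^esub> farr T (snd Q)) \<cdot>\<^bsub>A\<^esub> farr T (farr T e)"
    using endo.dom.Comp_assoc [OF TTe mult_in_hom [OF q(1)] q(2)] q(4) by simp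
  also have "\<dots> = snd Q \<cdot>\<^bsub>A\<^esub> farr T (snd Q \<cdot>\<^bsub>A\<^esub> farr T e)"
    using endo.dom.Comp_assoc [OF TTe Tq q(2)] endo.farr_Comp [OF Te q(2)] by simp
  finally show "snd Q \<cdot>\<^bsub>A\<^esub> farr T e \<in> alg_hom A T (fobj T X, \<mu> X) Q"
    using endo.dom.Comp_in_hom [OF Te q(2)] by (simp add: alg_hom_def)
  have "(snd Q \<cdot>\<^bsub>A\<^esub> farr T e) \<cdot>\<^bsub>A\<^esub> \<eta> X = (snd Q \<cdot>\<^bsub>A\<^esub> \<eta> (fst Q)) \<cdot>\<^bsub>A\<^esub> e"
    using endo.dom.Comp_assoc [OF unit_in_hom [OF X] Te q(2)] unit_natural [OF e]
      endo.dom.Comp_assoc [OF e unit_in_hom [OF q(1)] q(2)] by simp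
  also have "\<dots> = e" using q(3) e endo.dom.Ident_Comp by simp
  finally show "(snd Q \<cdot>\<^bsub>A\<^esub> farr T e) \<cdot>\<^bsub>A\<^esub> \<eta> X = e" .
qed

text \<open>Uniqueness half of the universal property: writing the identity of
  \<open>fobj T X\<close> as \<open>\<mu> X\<close> after \<open>farr T (\<eta> X)\<close> and
  moving \<open>h\<close> across \<open>\<mu> X\<close> leaves an expression in the restriction of
  \<open>h\<close> along the unit.\<close>

lemma free_alg_hom_determined:
  assumes "Q \<in> algebras A T \<eta> \<mu>" "X \<in> Obj A" "h \<in> alg_hom A T (fobj T X, \<mu> X) Q"
  shows "h = snd Q \<cdot>\<^bsub>A\<^esub> farr T (h \<cdot>\<^bsub>A\<^esub> \<eta> X)"
proof -
  have h: "h \<in> hom A (fobj T X) (fst Q)" "h \<cdot>\<^bsub>A\<^esub> \<mu> X = snd Q \<cdot>\<^bsub>A\<^esub> farr T h"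
    using alg_homD [OF assms(3)] by simp_all
  note \<eta> = unit_in_hom [OF assms(2)] and T\<eta> = T_in_hom [OF unit_in_hom [OF assms(2)]]
  have "h = h \<cdot>\<^bsub>A\<^esub> (\<mu> X \<cdot>\<^bsub>A\<^esub> farr T (\<eta> X))"
    using unit_right [OF assms(2)] h(1) endo.dom.Comp_Ident by simp
  also have "\<dots> = (snd Q \<cdot>\<^bsub>A\<^esub> farr T h) \<cdot>\<^bsub>A\<^esub> farr T (\<eta> X)"
    using endo.dom.Comp_assoc [OF T\<eta> mult_in_hom [OF assms(2)] h(1)] h(2) by simp
  also have "\<dots> = snd Q \<cdot>\<^bsub>A\<^esub> farr T (h \<cdot>\<^bsub>A\<^esub> \<eta> X)"
    using endo.dom.Comp_assoc [OF T\<eta> T_in_hom [OF h(1)] algebrasD(2) [OF assms(1)]]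
      endo.farr_Comp [OF \<eta> h(1)] by simp
  finally show ?thesis .
qed

text \<open>The composite is an endomorphism of the free algebra that restricts to
  \<open>\<eta> X\<close> along the unit. An algebra map out of the free algebra is determined by
  this restriction, and the identity has the same one.\<close>

lemma free_algebra_retract:
  assumes Q: "Q \<in> algebras A T \<eta> \<mu>" and X: "X \<in> Obj A"
    and k: "k \<in> alg_hom A T Q (fobj T X, \<mu> X)"
    and e: "e \<in> hom A X (fst Q)" "k \<cdot>\<^bsub>A\<^esub> e = \<eta> X"
  shows "k \<cdot>\<^bsub>A\<^esub> (snd Q \<cdot>\<^bsub>A\<^esub> farr T e) = Ident A (fobj T X)"
proof -
  let ?F = "(fobj T X, \<mu> X)" and ?e = "snd Q \<cdot>\<^bsub>A\<^esub> farr T e"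
  note F = free_algebra [OF X]
  have ke: "k \<cdot>\<^bsub>A\<^esub> ?e \<in> alg_hom A T ?F ?F"
    using alg_hom_Comp [OF free_extension(1) [OF Q e(1)] k F Q F] .
  have "(k \<cdot>\<^bsub>A\<^esub> ?e) \<cdot>\<^bsub>A\<^esub> \<eta> X = \<eta> X"
    using endo.dom.Comp_assoc [OF unit_in_hom [OF X]] free_extension [OF Q e(1)] e(2)
      alg_homD(1) k by (metis fst_conv)
  then have "k \<cdot>\<^bsub>A\<^esub> ?e = \<mu> X \<cdot>\<^bsub>A\<^esub> farr T (\<eta> X)"
    using free_alg_hom_determined [OF F X ke] by simp
  then show ?thesis using unit_right [OF X] by simp
qed

end

subsection \<open>Lifts of a colocalization to algebras\<close>

locale monad_idempotent_comonad = idempotent_comonad A C c + monad A T \<eta> \<mu>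
  for A :: "('o, 'm) cat" (structure) and C c T \<eta> \<mu>
begin

text \<open>The extension of \<open>e\<close> to the free algebra is a section of \<open>k\<close>,
  so \<open>fobj T X\<close> is a retract of the colocal carrier of \<open>Q\<close>. The lifts of
  algebra structures and the lifts of the colocalization both enter through this criterion.\<close>

lemma colocal_T:
  assumes "Q \<in> algebras A T \<eta> \<mu>" "colocal A c (fst Q)" "X \<in> Obj A"
    and "k \<in> alg_hom A T Q (fobj T X, \<mu> X)" "e \<in> hom A X (fst Q)" "k \<cdot> e = \<eta> X"
  shows "colocal A c (fobj T X)"
  using colocal_retract [OF assms(2)] free_algebra_retract [OF assms(1,3-6)]
    alg_homD(1) [OF assms(4)] alg_homD(1) [OF free_extension(1) [OF assms(1,5)]]
  by simp

lemma preserves_colocal_T_if_lifts: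
  assumes "\<And>X a. (X, a) \<in> algebras A T \<eta> \<mu> \<Longrightarrow>
      (fobj C X, s (X, a)) \<in> algebras A T \<eta> \<mu> \<and> c X \<in> alg_hom A T (fobj C X, s (X, a)) (X, a)"
  shows "preserves_colocal A c A c T"
  unfolding preserves_colocal_def
proof (intro ballI impI)
  fix X assume X: "X \<in> Obj A" "colocal A c X"
  \<comment> \<open>Here \<open>Q\<close> is the lifted structure on
    \<open>fobj C (fobj T X)\<close> and \<open>k\<close> is the counit at \<open>fobj T X\<close>.
    Colocality of \<open>X\<close> lets the unit factor through that counit.\<close>
  obtain e where "e \<in> hom A X (fobj C (fobj T X))" "c (fobj T X) \<cdot> e = \<eta> X"
    using counit_factor X unit_in_hom by blast
  then show "colocal A c (fobj T X)"
    using colocal_T [OF _ _ X(1)] assms [OF free_algebra [OF X(1)]]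
      colocal_C [OF endo.fobj_in_Obj [OF X(1)]] by (metis fst_conv)
qed

text \<open>The two functors agree on all algebras and algebra maps, so identities serve as the
  components of the isomorphism.\<close>

lemma strict_lift_iso_lift:
  assumes "strict_lift A T \<eta> \<mu> C c CT cT"
  shows "iso_lift A T \<eta> \<mu> C CT cT"
proof -
  have CT: "colocalization (EM A T \<eta> \<mu>) CT cT"
    and eq: "functor_eq (EM A T \<eta> \<mu>) (C \<circ>\<^sub>F forget) (forget \<circ>\<^sub>F CT)"
    using assms by (auto simp: strict_lift_def)
  have obj: "fst (fobj CT P) = fobj C (fst P)" if "P \<in> algebras A T \<eta> \<mu>" for P
    using eq that by (simp add: functor_eq_def)
  have arr: "farr forget (farr CT f) = farr C (farr forget f)" if "f \<in> Arr (EM A T \<eta> \<mu>)" for f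
    using eq that by (simp add: functor_eq_def)
  interpret CT: idempotent_comonad "EM A T \<eta> \<mu>" CT cT
    using CT by (rule colocalization_idempotent_comonad)
  interpret U: is_functor "EM A T \<eta> \<mu>" A forget by (rule forget_functor)
  interpret CU: is_functor "EM A T \<eta> \<mu>" A "C \<circ>\<^sub>F forget"
    using comp_ftr_functor [OF U.is_functor_axioms source.is_functor_axioms] .
  interpret UC: is_functor "EM A T \<eta> \<mu>" A "forget \<circ>\<^sub>F CT"
    using comp_ftr_functor [OF CT.source.is_functor_axioms U.is_functor_axioms] .
  have "nat_iso (EM A T \<eta> \<mu>) A (C \<circ>\<^sub>F forget) (forget \<circ>\<^sub>F CT) (\<lambda>P. Ident A (fobj C (fst P)))"
  proof
    fix P assume "P \<in> Obj (EM A T \<eta> \<mu>)"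
    then have P: "P \<in> algebras A T \<eta> \<mu>" by simp
    then have CP: "fobj C (fst P) \<in> Obj A" using source.fobj_in_Obj algebrasD(1) by metis
    show "Ident A (fobj C (fst P)) \<in> hom A (fobj (C \<circ>\<^sub>F forget) P) (fobj (forget \<circ>\<^sub>F CT) P)"
      using obj [OF P] Ident_in_hom [OF CP] by simp
    show "is_iso A (Ident A (fobj C (fst P)))" using is_iso_Ident CP .
  next
    fix f P Q assume f: "f \<in> hom (EM A T \<eta> \<mu>) P Q"
    then have "farr C (farr forget f) \<in> hom A (fobj C (fst P)) (fobj C (fst Q))"
      using CU.farr_in_hom by simp
    moreover have "farr forget (farr CT f) = farr C (farr forget f)"
      using arr f by (auto simp: hom_def)
    ultimately show "Ident A (fobj C (fst Q)) \<cdot> farr (C \<circ>\<^sub>F forget) f =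
        farr (forget \<circ>\<^sub>F CT) f \<cdot> Ident A (fobj C (fst P))"
      using Ident_Comp Comp_Ident by simp
  qed
  then show ?thesis using CT by (auto simp: iso_lift_def)
qed

text \<open>Naturality of the isomorphism \<open>CU \<cong> UC\<^sup>T\<close> at \<open>c\<^sup>T\<close> makes \<open>Uc\<^sup>T\<close> a \<open>C\<close>-equivalence with
  colocal source, hence isomorphic to \<open>c\<close> over its target; no compatibility of the given
  isomorphism with the counits is required.\<close>

lemma iso_lift_counit:
  assumes "iso_lift A T \<eta> \<mu> C CT cT" and P: "P \<in> algebras A T \<eta> \<mu>"
  obtains \<theta> where "\<theta> \<in> hom A (fobj C (fst P)) (fst (fobj CT P))" "is_iso A \<theta>"
    "farr forget (cT P) \<cdot> \<theta> = c (fst P)" "colocal A c (fst (fobj CT P))"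
proof -
  obtain t where t: "nat_iso (EM A T \<eta> \<mu>) A (C \<circ>\<^sub>F forget) (forget \<circ>\<^sub>F CT) t"
    and CT: "colocalization (EM A T \<eta> \<mu>) CT cT"
    using assms by (auto simp: iso_lift_def)
  interpret CT: idempotent_comonad "EM A T \<eta> \<mu>" CT cT
    using CT by (rule colocalization_idempotent_comonad)
  interpret t: nat_iso "EM A T \<eta> \<mu>" A "C \<circ>\<^sub>F forget" "forget \<circ>\<^sub>F CT" t by fact
  interpret U: is_functor "EM A T \<eta> \<mu>" A forget by (rule forget_functor)
  define Z where "Z = fst (fobj CT P)"
  define h where "h = farr forget (cT P)"
  have cTP: "cT P \<in> hom (EM A T \<eta> \<mu>) (fobj CT P) P" using CT.c_in_hom P by simp
  have CTP: "fobj CT P \<in> algebras A T \<eta> \<mu>" using CT.source.fobj_in_Obj P by simp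
  have h: "h \<in> hom A Z (fst P)" using U.farr_in_hom [OF cTP] by (simp add: h_def Z_def)
  have X: "fst P \<in> Obj A" and Z: "Z \<in> Obj A" using h hom_Obj by blast+
  have tP: "t Q \<in> hom A (fobj C (fst Q)) (fst (fobj CT Q))" "is_iso A (t Q)"
    if "Q \<in> algebras A T \<eta> \<mu>" for Q
    using t.component_in_hom [of Q] t.component_iso [of Q] that by simp_all
  obtain t' where t': "t' \<in> hom A Z (fobj C (fst P))" "t P \<cdot> t' = Ident A Z"
    using is_isoE [OF tP(2,1) [OF P]] unfolding Z_def by metis
  \<comment> \<open>The component \<open>t P\<close> identifies \<open>Z\<close> with the colocal
    object \<open>fobj C (fst P)\<close> and thus exhibits \<open>Z\<close> as a retract of
    it.\<close>
  have colZ: "colocal A c Z"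
    using colocal_retract [OF colocal_C [OF X]] tP(1) [OF P] t' by (simp add: Z_def)
  have "t P \<cdot> farr C h = farr forget (farr CT (cT P)) \<cdot> t (fobj CT P)"
    using t.naturality [OF cTP] by (simp add: h_def)
  moreover have "is_iso A (farr forget (farr CT (cT P)))"
  proof -
    \<comment> \<open>This arrow equals the counit \<open>cT\<close> at \<open>fobj CT P\<close>,
      which is invertible because \<open>CT\<close> is idempotent.\<close>
    have "is_iso (EM A T \<eta> \<mu>) (farr CT (cT P))"
      using CT.C_counit CT.iso_counit_C P by simp
    then show ?thesis using U.farr_iso CT.source.farr_in_hom [OF cTP] by blast
  qed
  moreover have "farr forget (farr CT (cT P)) \<in> hom A (fst (fobj CT (fobj CT P))) Z"
    using U.farr_in_hom [OF CT.source.farr_in_hom [OF cTP]] by (simp add: Z_def)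
  ultimately have "is_iso A (t P \<cdot> farr C h)"
    using is_iso_Comp [OF tP(2,1) [OF CTP]] by simp
  moreover have Ch: "farr C h \<in> hom A (fobj C Z) (fobj C (fst P))"
    using h source.farr_in_hom by blast
  ultimately have isoCh: "is_iso A (farr C h)"
    using is_iso_right_factor [OF tP(2,1) [OF P]] by blast
  obtain k where k: "k \<in> hom A (fobj C (fst P)) (fobj C Z)"
    "farr C h \<cdot> k = Ident A (fobj C (fst P))" "is_iso A k"
    using is_isoE [OF isoCh Ch] by blast
  have cZ: "c Z \<in> hom A (fobj C Z) Z" "is_iso A (c Z)"
    using c_in_hom Z colZ by (auto simp: colocal_def)
  \<comment> \<open>The desired \<theta> is \<open>c Z \<cdot> k\<close> with \<open>k\<close>
    inverse to \<open>farr C h\<close>. Naturality of \<open>c\<close> at \<open>h\<close> gives the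
    triangle, and both factors are invertible.\<close>
  have "h \<cdot> (c Z \<cdot> k) = (c (fst P) \<cdot> farr C h) \<cdot> k"
    using Comp_assoc [OF k(1) cZ(1) h] c_natural [OF h] by simp
  also have "\<dots> = c (fst P)"
    using Comp_assoc [OF k(1) Ch c_in_hom [OF X]] k(2) Comp_Ident c_in_hom [OF X] by simp
  finally show ?thesis
    using that [of "c Z \<cdot> k"] Comp_in_hom [OF k(1) cZ(1)] is_iso_Comp [OF k(3,1) cZ(2,1)] colZ
    by (simp add: Z_def h_def)
qed

text \<open>The algebra with colocal carrier is now \<open>CT\<close> of the free algebra, and its
  map to the free algebra is the counit \<open>cT\<close>. The isomorphism \<theta> converts a
  factorization of the unit through \<open>c\<close> into one through the map underlying
  \<open>cT\<close>.\<close>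

lemma preserves_colocal_T_if_iso_lift:
  assumes "iso_lift A T \<eta> \<mu> C CT cT"
  shows "preserves_colocal A c A c T"
  unfolding preserves_colocal_def
proof (intro ballI impI)
  fix X assume X: "X \<in> Obj A" "colocal A c X"
  let ?F = "(fobj T X, \<mu> X)"
  interpret CT: idempotent_comonad "EM A T \<eta> \<mu>" CT cT
    using assms colocalization_idempotent_comonad by (auto simp: iso_lift_def)
  note F = free_algebra [OF X(1)]
  obtain \<theta> where \<theta>: "\<theta> \<in> hom A (fobj C (fobj T X)) (fst (fobj CT ?F))"
    "farr forget (cT ?F) \<cdot> \<theta> = c (fobj T X)" "colocal A c (fst (fobj CT ?F))"
    using iso_lift_counit [OF assms F] by (metis fst_conv)
  obtain e where e: "e \<in> hom A X (fobj C (fobj T X))" "c (fobj T X) \<cdot> e = \<eta> X"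
    using counit_factor X unit_in_hom by blast
  have CF: "fobj CT ?F \<in> algebras A T \<eta> \<mu>" using CT.source.fobj_in_Obj F by simp
  have "cT ?F \<in> hom (EM A T \<eta> \<mu>) (fobj CT ?F) ?F" using CT.c_in_hom F by simp
  then have k: "farr forget (cT ?F) \<in> alg_hom A T (fobj CT ?F) ?F" by (auto simp: EM_hom)
  have "farr forget (cT ?F) \<cdot> (\<theta> \<cdot> e) = \<eta> X"
    using Comp_assoc [OF e(1) \<theta>(1) alg_homD(1) [OF k]] \<theta>(2) e(2) by simp
  then show "colocal A c (fobj T X)"
    using colocal_T [OF CF \<theta>(3) X(1) k Comp_in_hom [OF e(1) \<theta>(1)]] by blast
qed

text \<open>The maps \<open>c (fst P)\<close> and \<open>farr forget (cT P)\<close> differ by the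
  isomorphism \<theta>, and an algebra map is invertible exactly when its underlying map is.\<close>

lemma iso_lift_forget_colocal:
  assumes "iso_lift A T \<eta> \<mu> C CT cT" and P: "P \<in> algebras A T \<eta> \<mu>"
  shows "colocal (EM A T \<eta> \<mu>) cT P \<longleftrightarrow> colocal A c (fst P)"
proof -
  interpret CT: idempotent_comonad "EM A T \<eta> \<mu>" CT cT
    using assms(1) colocalization_idempotent_comonad by (auto simp: iso_lift_def)
  interpret U: is_functor "EM A T \<eta> \<mu>" A forget by (rule forget_functor)
  have cT: "cT P \<in> hom (EM A T \<eta> \<mu>) (fobj CT P) P" using CT.c_in_hom P by simp
  have UcT: "farr forget (cT P) \<in> hom A (fst (fobj CT P)) (fst P)"
    using U.farr_in_hom [OF cT] by simp
  obtain \<theta> where \<theta>: "\<theta> \<in> hom A (fobj C (fst P)) (fst (fobj CT P))" "is_iso A \<theta>"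
    "farr forget (cT P) \<cdot> \<theta> = c (fst P)"
    using iso_lift_counit [OF assms] by metis
  have "is_iso (EM A T \<eta> \<mu>) (cT P) \<longleftrightarrow> is_iso A (farr forget (cT P))"
    using is_iso_EM_iff cT by (auto simp: hom_def)
  also have "\<dots> \<longleftrightarrow> is_iso A (c (fst P))"
    using is_iso_Comp [OF \<theta>(2,1) _ UcT] is_iso_left_factor [OF \<theta>(2,1) UcT] \<theta>(3) by auto
  finally show ?thesis using P algebrasD(1) [OF P] by (simp add: colocal_def)
qed

text \<open>In the naturality square of \<open>t\<close> at \<open>f\<close> the two components of
  \<open>t\<close> are invertible, so one of the other two sides is invertible exactly when the
  other is. Passing between algebra maps and their underlying maps finishes the argument.\<close>

lemma iso_lift_forget_equivalence:
  assumes "iso_lift A T \<eta> \<mu> C CT cT" and f: "f \<in> Arr (EM A T \<eta> \<mu>)"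
  shows "equivalence (EM A T \<eta> \<mu>) CT f \<longleftrightarrow> equivalence A C (farr forget f)"
proof -
  obtain t where t: "nat_iso (EM A T \<eta> \<mu>) A (C \<circ>\<^sub>F forget) (forget \<circ>\<^sub>F CT) t"
    and CT: "colocalization (EM A T \<eta> \<mu>) CT cT"
    using assms by (auto simp: iso_lift_def)
  interpret CT: idempotent_comonad "EM A T \<eta> \<mu>" CT cT
    using CT by (rule colocalization_idempotent_comonad)
  interpret t: nat_iso "EM A T \<eta> \<mu>" A "C \<circ>\<^sub>F forget" "forget \<circ>\<^sub>F CT" t by fact
  interpret U: is_functor "EM A T \<eta> \<mu>" A forget by (rule forget_functor)
  obtain P Q where f: "f \<in> hom (EM A T \<eta> \<mu>) P Q" using f by (auto simp: hom_def)
  have PQ: "P \<in> Obj (EM A T \<eta> \<mu>)" "Q \<in> Obj (EM A T \<eta> \<mu>)" using f CT.hom_Obj by blast+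
  note tP = t.component_in_hom [OF PQ(1)] t.component_iso [OF PQ(1)]
    and tQ = t.component_in_hom [OF PQ(2)] t.component_iso [OF PQ(2)]
  note Uf = t.source.farr_in_hom [OF f] and CTf = t.target.farr_in_hom [OF f]
  have "is_iso A (farr (C \<circ>\<^sub>F forget) f) \<longleftrightarrow> is_iso A (t Q \<cdot> farr (C \<circ>\<^sub>F forget) f)"
    using is_iso_Comp [OF _ Uf tQ(2,1)] is_iso_right_factor [OF tQ(2,1) Uf] by blast
  also have "\<dots> \<longleftrightarrow> is_iso A (farr (forget \<circ>\<^sub>F CT) f)"
    using is_iso_Comp [OF tP(2,1) _ CTf] is_iso_left_factor [OF tP(2,1) CTf] t.naturality [OF f]
    by auto
  also have "\<dots> \<longleftrightarrow> is_iso (EM A T \<eta> \<mu>) (farr CT f)"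
    using is_iso_EM_iff CT.source.farr_in_hom [OF f] by (auto simp: hom_def)
  finally show ?thesis
    using assms(2) U.farr_in_hom [OF f] by (simp add: equivalence_def hom_def)
qed

end

text \<open>On objects, the strict equalities leave only the structure map of
  \<open>fobj CT P\<close> open. That \<open>c (fst P)\<close> underlies the arrow
  \<open>cT P\<close> makes it an algebra map for this structure, which is what the uniqueness
  argument needs.\<close>

lemma (in monad_idempotent_comonad) strict_lift_structure:
  assumes "strict_lift A T \<eta> \<mu> C c CT cT" "P \<in> algebras A T \<eta> \<mu>"
  shows "fobj CT P = (fobj C (fst P), snd (fobj CT P))"
    and "fobj CT P \<in> algebras A T \<eta> \<mu>"
    and "c (fst P) \<in> alg_hom A T (fobj CT P) P"
    and "cT P = (fobj CT P, c (fst P), P)"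
proof -
  have CT: "colocalization (EM A T \<eta> \<mu>) CT cT"
    and eq: "functor_eq (EM A T \<eta> \<mu>) (C \<circ>\<^sub>F forget) (forget \<circ>\<^sub>F CT)"
    and teq: "trans_eq (EM A T \<eta> \<mu>) (c \<circ> fobj forget) (farr forget \<circ> cT)"
    using assms(1) by (auto simp: strict_lift_def)
  interpret CT: idempotent_comonad "EM A T \<eta> \<mu>" CT cT
    using CT by (rule colocalization_idempotent_comonad)
  have "fst (fobj CT P) = fobj C (fst P)"
    using eq assms(2) by (simp add: functor_eq_def)
  then show "fobj CT P = (fobj C (fst P), snd (fobj CT P))" by (simp add: prod_eq_iff)
  show "fobj CT P \<in> algebras A T \<eta> \<mu>" using CT.source.fobj_in_Obj assms(2) by simp
  obtain g where g: "cT P = (fobj CT P, g, P)" "g \<in> alg_hom A T (fobj CT P) P"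
    using CT.c_in_hom [of P] assms(2) by (auto simp: EM_hom)
  have "c (fst P) = farr forget (cT P)" using teq assms(2) by (simp add: trans_eq_def)
  then have "c (fst P) = g" using g(1) by simp
  then show "c (fst P) \<in> alg_hom A T (fobj CT P) P" "cT P = (fobj CT P, c (fst P), P)"
    using g by simp_all
qed

lemma (in monad_idempotent_comonad) strict_lift_arrow:
  assumes "strict_lift A T \<eta> \<mu> C c CT cT" "f \<in> hom (EM A T \<eta> \<mu>) P Q"
  shows "farr CT f = (fobj CT P, farr C (farr forget f), fobj CT Q)"
proof -
  have CT: "colocalization (EM A T \<eta> \<mu>) CT cT"
    and eq: "functor_eq (EM A T \<eta> \<mu>) (C \<circ>\<^sub>F forget) (forget \<circ>\<^sub>F CT)"
    using assms(1) by (auto simp: strict_lift_def)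
  interpret CT: idempotent_comonad "EM A T \<eta> \<mu>" CT cT
    using CT by (rule colocalization_idempotent_comonad)
  obtain g where g: "farr CT f = (fobj CT P, g, fobj CT Q)"
    using CT.source.farr_in_hom [OF assms(2)] by (auto simp: EM_hom)
  have "f \<in> Arr (EM A T \<eta> \<mu>)" using assms(2) by (simp add: hom_def)
  then have "farr C (farr forget f) = farr forget (farr CT f)"
    using eq by (simp add: functor_eq_def)
  then show ?thesis using g by simp
qed

subsection \<open>Lifting along a monad that preserves colocal objects\<close>

locale colocal_preserving_monad = monad_idempotent_comonad +
  assumes preserves: "preserves_colocal A c A c T"
begin

lemma colocal_T_C: "X \<in> Obj A \<Longrightarrow> colocal A c (fobj T (fobj C X))"
  using preserves colocal_C source.fobj_in_Obj by (simp add: preserves_colocal_def)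

lemma colocal_T_T_C: "X \<in> Obj A \<Longrightarrow> colocal A c (fobj T (fobj T (fobj C X)))"
  using preserves colocal_T_C source.fobj_in_Obj endo.fobj_in_Obj
  by (simp add: preserves_colocal_def)

text \<open>The description denotes for every algebra \<open>P\<close>: since \<open>T\<close>
  applied to \<open>fobj C (fst P)\<close> is colocal, the map
  \<open>snd P \<cdot> farr T (c (fst P))\<close> factors uniquely through the counit.\<close>

definition lifted_structure :: "'a \<times> 'b \<Rightarrow> 'b" where
  "lifted_structure P = (THE a'. a' \<in> hom A (fobj T (fobj C (fst P))) (fobj C (fst P)) \<and>
     c (fst P) \<cdot> a' = snd P \<cdot> farr T (c (fst P)))"

definition lifted_algebra :: "'a \<times> 'b \<Rightarrow> 'a \<times> 'b" where
  "lifted_algebra P = (fobj C (fst P), lifted_structure P)"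

lemma fst_lifted_algebra [simp]: "fst (lifted_algebra P) = fobj C (fst P)"
  and snd_lifted_algebra [simp]: "snd (lifted_algebra P) = lifted_structure P"
  by (simp_all add: lifted_algebra_def)

lemma structure_unique:
  assumes "P \<in> algebras A T \<eta> \<mu>"
    and "a' \<in> hom A (fobj T (fobj C (fst P))) (fobj C (fst P))"
    and "a'' \<in> hom A (fobj T (fobj C (fst P))) (fobj C (fst P))"
    and "c (fst P) \<cdot> a' = snd P \<cdot> farr T (c (fst P))"
    and "c (fst P) \<cdot> a'' = snd P \<cdot> farr T (c (fst P))"
  shows "a' = a''"
  using counit_mono [OF colocal_T_C algebrasD(1)] algebrasD(1) assms by metis

lemma lifted_structure:
  assumes P: "P \<in> algebras A T \<eta> \<mu>"
  shows "lifted_structure P \<in> hom A (fobj T (fobj C (fst P))) (fobj C (fst P))"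
    and "c (fst P) \<cdot> lifted_structure P = snd P \<cdot> farr T (c (fst P))"
proof -
  note p = algebrasD [OF P]
  have "snd P \<cdot> farr T (c (fst P)) \<in> hom A (fobj T (fobj C (fst P))) (fst P)"
    using Comp_in_hom T_in_hom c_in_hom p by blast
  then obtain a' where "a' \<in> hom A (fobj T (fobj C (fst P))) (fobj C (fst P))"
    "c (fst P) \<cdot> a' = snd P \<cdot> farr T (c (fst P))"
    using counit_factor colocal_T_C p(1) by blast
  then have ex1: "\<exists>!a'. a' \<in> hom A (fobj T (fobj C (fst P))) (fobj C (fst P)) \<and>
      c (fst P) \<cdot> a' = snd P \<cdot> farr T (c (fst P))"
    using structure_unique [OF P] by blast
  from theI' [OF ex1]
  show "lifted_structure P \<in> hom A (fobj T (fobj C (fst P))) (fobj C (fst P))"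
    "c (fst P) \<cdot> lifted_structure P = snd P \<cdot> farr T (c (fst P))"
    unfolding lifted_structure_def by blast+
qed

lemma counit_alg_hom:
  assumes "P \<in> algebras A T \<eta> \<mu>"
  shows "c (fst P) \<in> alg_hom A T (lifted_algebra P) P"
  using lifted_structure(2) [OF assms] c_in_hom algebrasD(1) [OF assms] by (simp add: alg_hom_def)

text \<open>After composition with the counit, each law reduces to the corresponding law of
  \<open>P\<close>. The counit may be cancelled because the sources are colocal:
  \<open>fobj C (fst P)\<close> for the unit law, and \<open>T\<close> applied twice to it for
  associativity.\<close>

lemma lifted_algebra:
  assumes P: "P \<in> algebras A T \<eta> \<mu>"
  shows "lifted_algebra P \<in> algebras A T \<eta> \<mu>"
proof -
  let ?X = "fst P" and ?a = "snd P" and ?CX = "fobj C (fst P)" and ?s = "lifted_structure P"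
  note p = algebrasD [OF P] and s = lifted_structure [OF P]
  have CX: "?CX \<in> Obj A" using source.fobj_in_Obj p(1) .
  note cX = c_in_hom [OF p(1)]
  note TcX = T_in_hom [OF cX] and TTcX = T_in_hom [OF T_in_hom [OF cX]] and Ts = T_in_hom [OF s(1)]
    and Ta = T_in_hom [OF p(2)] and \<eta>CX = unit_in_hom [OF CX] and \<mu>CX = mult_in_hom [OF CX]
  have "c ?X \<cdot> (?s \<cdot> \<eta> ?CX) = (?a \<cdot> farr T (c ?X)) \<cdot> \<eta> ?CX"
    using Comp_assoc [OF \<eta>CX s(1) cX] s(2) by simp
  also have "\<dots> = (?a \<cdot> \<eta> ?X) \<cdot> c ?X"
    using Comp_assoc [OF \<eta>CX TcX p(2)] Comp_assoc [OF cX unit_in_hom [OF p(1)] p(2)]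
      unit_natural [OF cX] by simp
  also have "\<dots> = c ?X \<cdot> Ident A ?CX" using p(3) Ident_Comp [OF cX] Comp_Ident [OF cX] by simp
  finally have unit: "?s \<cdot> \<eta> ?CX = Ident A ?CX"
    using counit_mono [OF colocal_C [OF p(1)] p(1)] Comp_in_hom [OF \<eta>CX s(1)] Ident_in_hom [OF CX]
    by blast
  have "c ?X \<cdot> (?s \<cdot> farr T ?s) = (?a \<cdot> farr T (c ?X)) \<cdot> farr T ?s"
    using Comp_assoc [OF Ts s(1) cX] s(2) by simp
  also have "\<dots> = ?a \<cdot> farr T (?a \<cdot> farr T (c ?X))"
    using Comp_assoc [OF Ts TcX p(2)] endo.farr_Comp [OF s(1) cX] s(2) by simp
  also have "\<dots> = (?a \<cdot> farr T ?a) \<cdot> farr T (farr T (c ?X))"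
    using endo.farr_Comp [OF TcX p(2)] Comp_assoc [OF TTcX Ta p(2)] by simp
  also have "\<dots> = ?a \<cdot> (farr T (c ?X) \<cdot> \<mu> ?CX)"
    using p(4) Comp_assoc [OF TTcX mult_in_hom [OF p(1)] p(2)] mult_natural [OF cX] by simp
  also have "\<dots> = c ?X \<cdot> (?s \<cdot> \<mu> ?CX)"
    using Comp_assoc [OF \<mu>CX TcX p(2)] Comp_assoc [OF \<mu>CX s(1) cX] s(2) by simp
  finally have "?s \<cdot> farr T ?s = ?s \<cdot> \<mu> ?CX"
    using counit_mono [OF colocal_T_T_C [OF p(1)] p(1)] Comp_in_hom [OF Ts s(1)]
      Comp_in_hom [OF \<mu>CX s(1)] by blast
  then show ?thesis using unit CX s(1) by (simp add: lifted_algebra_def algebras_def)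
qed

text \<open>Both sides of the algebra map equation start at the colocal object
  \<open>fobj T (fobj C (fst P))\<close>, so they may be compared after \<open>c (fst Q)\<close>.
  There, naturality of \<open>c\<close> reduces the equation to that of \<open>g\<close>.\<close>

lemma C_alg_hom:
  assumes P: "P \<in> algebras A T \<eta> \<mu>" and Q: "Q \<in> algebras A T \<eta> \<mu>" and "g \<in> alg_hom A T P Q"
  shows "farr C g \<in> alg_hom A T (lifted_algebra P) (lifted_algebra Q)"
proof -
  note p = algebrasD [OF P] and q = algebrasD [OF Q] and g = alg_homD [OF assms(3)]
    and s = lifted_structure [OF P] and s' = lifted_structure [OF Q]
  note cP = c_in_hom [OF p(1)] and cQ = c_in_hom [OF q(1)] and Cg = source.farr_in_hom [OF g(1)]
  note TcP = T_in_hom [OF cP] and TcQ = T_in_hom [OF cQ] and TCg = T_in_hom [OF Cg]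
    and Tg = T_in_hom [OF g(1)]
  have "c (fst Q) \<cdot> (farr C g \<cdot> lifted_structure P) = (g \<cdot> c (fst P)) \<cdot> lifted_structure P"
    using Comp_assoc [OF s(1) Cg cQ] c_natural [OF g(1)] by simp
  also have "\<dots> = (g \<cdot> snd P) \<cdot> farr T (c (fst P))"
    using Comp_assoc [OF s(1) cP g(1)] Comp_assoc [OF TcP p(2) g(1)] s(2) by simp
  also have "\<dots> = snd Q \<cdot> farr T (g \<cdot> c (fst P))"
    using g(2) Comp_assoc [OF TcP Tg q(2)] endo.farr_Comp [OF cP g(1)] by simp
  also have "\<dots> = (snd Q \<cdot> farr T (c (fst Q))) \<cdot> farr T (farr C g)"
    using endo.farr_Comp [OF Cg cQ] Comp_assoc [OF TCg TcQ q(2)] c_natural [OF g(1)] by simp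
  also have "\<dots> = c (fst Q) \<cdot> (lifted_structure Q \<cdot> farr T (farr C g))"
    using s'(2) Comp_assoc [OF TCg s'(1) cQ] by simp
  finally have "farr C g \<cdot> lifted_structure P = lifted_structure Q \<cdot> farr T (farr C g)"
    using counit_mono [OF colocal_T_C [OF p(1)] q(1)] Comp_in_hom [OF s(1) Cg]
      Comp_in_hom [OF TCg s'(1)] by blast
  then show ?thesis using Cg by (simp add: alg_hom_def)
qed

text \<open>The algebra map equation for \<open>c (fst P)\<close> is precisely the factorization
  that characterizes \<open>lifted_structure P\<close>.\<close>

lemma lifted_algebra_unique:
  assumes "P \<in> algebras A T \<eta> \<mu>" "(fobj C (fst P), a') \<in> algebras A T \<eta> \<mu>"
    and "c (fst P) \<in> alg_hom A T (fobj C (fst P), a') P"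
  shows "(fobj C (fst P), a') = lifted_algebra P"
  using structure_unique [OF assms(1) _ lifted_structure(1) [OF assms(1)] _
      lifted_structure(2) [OF assms(1)]] algebrasD(2) [OF assms(2)] alg_homD(2) [OF assms(3)]
  by (simp add: lifted_algebra_def)

definition lifted_ftr ::
  "('a \<times> 'b, ('a \<times> 'b) \<times> 'b \<times> ('a \<times> 'b), 'a \<times> 'b, ('a \<times> 'b) \<times> 'b \<times> ('a \<times> 'b)) ftr" where
  "lifted_ftr = \<lparr>fobj = lifted_algebra,
     farr = (\<lambda>(P, g, Q). (lifted_algebra P, farr C g, lifted_algebra Q))\<rparr>"

definition lifted_counit :: "'a \<times> 'b \<Rightarrow> ('a \<times> 'b) \<times> 'b \<times> ('a \<times> 'b)" where
  "lifted_counit P = (lifted_algebra P, c (fst P), P)"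

lemma lifted_ftr_simps [simp]:
  "fobj lifted_ftr P = lifted_algebra P"
  "farr lifted_ftr (P, g, Q) = (lifted_algebra P, farr C g, lifted_algebra Q)"
  by (simp_all add: lifted_ftr_def)

lemma lifted_idempotent_comonad:
  "idempotent_comonad (EM A T \<eta> \<mu>) lifted_ftr lifted_counit"
proof -
  interpret EM: category "EM A T \<eta> \<mu>" by (rule EM_category)
  interpret I: is_functor "EM A T \<eta> \<mu>" "EM A T \<eta> \<mu>" id_ftr by (rule EM.id_ftr_functor)
  interpret L: is_functor "EM A T \<eta> \<mu>" "EM A T \<eta> \<mu>" lifted_ftr
  proof
    show "farr lifted_ftr (Ident (EM A T \<eta> \<mu>) P) = Ident (EM A T \<eta> \<mu>) (fobj lifted_ftr P)"
      if "P \<in> Obj (EM A T \<eta> \<mu>)" for P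
      using that source.farr_Ident [OF algebrasD(1)] by simp
    show "farr lifted_ftr (g \<cdot>\<^bsub>EM A T \<eta> \<mu>\<^esub> f) = farr lifted_ftr g \<cdot>\<^bsub>EM A T \<eta> \<mu>\<^esub> farr lifted_ftr f"
      if "f \<in> hom (EM A T \<eta> \<mu>) P Q" "g \<in> hom (EM A T \<eta> \<mu>) Q R" for f g P Q R
      using that source.farr_Comp by (auto simp: EM_hom dest!: alg_homD(1))
  qed (auto simp: EM_hom intro: lifted_algebra C_alg_hom)
  show ?thesis
  proof
    show "lifted_counit P \<in> hom (EM A T \<eta> \<mu>) (fobj lifted_ftr P) (fobj id_ftr P)"
      if "P \<in> Obj (EM A T \<eta> \<mu>)" for P
      using that lifted_algebra counit_alg_hom by (simp add: lifted_counit_def EM_hom)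
    show "lifted_counit Q \<cdot>\<^bsub>EM A T \<eta> \<mu>\<^esub> farr lifted_ftr f =
        farr id_ftr f \<cdot>\<^bsub>EM A T \<eta> \<mu>\<^esub> lifted_counit P"
      if "f \<in> hom (EM A T \<eta> \<mu>) P Q" for f P Q
      using that c_natural by (auto simp: lifted_counit_def EM_hom dest!: alg_homD(1))
    fix P assume "P \<in> Obj (EM A T \<eta> \<mu>)"
    then have P: "P \<in> algebras A T \<eta> \<mu>" by simp
    \<comment> \<open>The underlying map is \<open>c\<close> at \<open>fobj C (fst P)\<close>, which
      is invertible in \<open>A\<close>; the forgetful functor reflects this.\<close>
    show "is_iso (EM A T \<eta> \<mu>) (lifted_counit (fobj lifted_ftr P))"
      using forget_reflects_iso [of "lifted_algebra (lifted_algebra P)" "c (fobj C (fst P))"]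
        lifted_algebra P counit_alg_hom [OF lifted_algebra [OF P]]
        iso_counit_C [OF algebrasD(1) [OF P]]
      by (simp add: lifted_counit_def) (simp add: EM_def)
    show "farr lifted_ftr (lifted_counit P) = lifted_counit (fobj lifted_ftr P)"
      using C_counit [OF algebrasD(1) [OF P]] by (simp add: lifted_counit_def)
  qed
qed

lemma strict_lift_lifted: "strict_lift A T \<eta> \<mu> C c lifted_ftr lifted_counit"
proof -
  interpret L: idempotent_comonad "EM A T \<eta> \<mu>" lifted_ftr lifted_counit
    by (rule lifted_idempotent_comonad)
  show ?thesis
    using L.colocalization
    by (auto simp: strict_lift_def functor_eq_def trans_eq_def lifted_counit_def EM_def)
qed

text \<open>Uniqueness of the lifted structures fixes \<open>CT\<close> on objects. An arrow of the
  Eilenberg--Moore category consists of its source, underlying map and target, so the values of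
  \<open>CT\<close> on arrows and the components of \<open>cT\<close> are fixed as well.\<close>

lemma strict_lift_eq_lifted:
  assumes "strict_lift A T \<eta> \<mu> C c CT cT"
  shows "functor_eq (EM A T \<eta> \<mu>) CT lifted_ftr" "trans_eq (EM A T \<eta> \<mu>) cT lifted_counit"
proof -
  have obj: "fobj CT P = lifted_algebra P" if "P \<in> algebras A T \<eta> \<mu>" for P
    using strict_lift_structure [OF assms that] lifted_algebra_unique [OF that] by metis
  show "functor_eq (EM A T \<eta> \<mu>) CT lifted_ftr"
    unfolding functor_eq_def
  proof (intro conjI ballI)
    fix f assume "f \<in> Arr (EM A T \<eta> \<mu>)"
    then obtain P g Q where f: "f = (P, g, Q)" "f \<in> hom (EM A T \<eta> \<mu>) P Q"
      by (auto simp: EM_def hom_def)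
    then have "P \<in> algebras A T \<eta> \<mu>" "Q \<in> algebras A T \<eta> \<mu>" by (auto simp: EM_hom)
    then show "farr CT f = farr lifted_ftr f"
      using strict_lift_arrow [OF assms f(2)] obj f(1) by simp
  qed (use obj in simp)
  show "trans_eq (EM A T \<eta> \<mu>) cT lifted_counit"
    using strict_lift_structure(4) [OF assms] obj by (simp add: trans_eq_def lifted_counit_def)
qed

end

section \<open>Equivalence of the four conditions, uniqueness, and properties of the forgetful
  functor\<close>

theorem theorem4p7:
  fixes \<C> :: "('o, 'm) cat"
    and T :: "('o, 'm, 'o, 'm) ftr" and \<eta> \<mu> :: "'o \<Rightarrow> 'm"
    and C :: "('o, 'm, 'o, 'm) ftr" and c :: "'o \<Rightarrow> 'm"
  assumes "monad \<C> T \<eta> \<mu>"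
    and "colocalization \<C> C c"
  shows
    "(preserves_colocal \<C> c \<C> c T \<longleftrightarrow>
        (\<exists>s. (\<forall>(X, a) \<in> algebras \<C> T \<eta> \<mu>.
                (fobj C X, s (X, a)) \<in> algebras \<C> T \<eta> \<mu> \<and>
                c X \<in> alg_hom \<C> T (fobj C X, s (X, a)) (X, a)) \<and>
             (\<forall>(X, a) \<in> algebras \<C> T \<eta> \<mu>. \<forall>(Y, b) \<in> algebras \<C> T \<eta> \<mu>.
                \<forall>g \<in> alg_hom \<C> T (X, a) (Y, b).
                  farr C g \<in> alg_hom \<C> T (fobj C X, s (X, a)) (fobj C Y, s (Y, b))))) \<and>
     (preserves_colocal \<C> c \<C> c T \<longleftrightarrow> (\<exists>CT cT. strict_lift \<C> T \<eta> \<mu> C c CT cT)) \<and>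
     (preserves_colocal \<C> c \<C> c T \<longleftrightarrow> (\<exists>CT cT. iso_lift \<C> T \<eta> \<mu> C CT cT)) \<and>
     (preserves_colocal \<C> c \<C> c T \<longrightarrow>
        (\<forall>(X, a) \<in> algebras \<C> T \<eta> \<mu>.
           \<exists>!a'. (fobj C X, a') \<in> algebras \<C> T \<eta> \<mu> \<and>
                c X \<in> alg_hom \<C> T (fobj C X, a') (X, a)) \<and>
        (\<forall>CT cT CT' cT'.
           strict_lift \<C> T \<eta> \<mu> C c CT cT \<and> strict_lift \<C> T \<eta> \<mu> C c CT' cT' \<longrightarrow>
             functor_eq (EM \<C> T \<eta> \<mu>) CT CT' \<and> trans_eq (EM \<C> T \<eta> \<mu>) cT cT') \<and>
        (\<forall>CT cT. strict_lift \<C> T \<eta> \<mu> C c CT cT \<or> iso_lift \<C> T \<eta> \<mu> C CT cT \<longrightarrow>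
             preserves_colocal (EM \<C> T \<eta> \<mu>) cT \<C> c forget \<and>
             reflects_colocal (EM \<C> T \<eta> \<mu>) cT \<C> c forget \<and>
             preserves_equivalences (EM \<C> T \<eta> \<mu>) CT \<C> C forget \<and>
             reflects_equivalences (EM \<C> T \<eta> \<mu>) CT \<C> C forget))"
proof -
  let ?a = "preserves_colocal \<C> c \<C> c T" and ?EM = "EM \<C> T \<eta> \<mu>"
  interpret idempotent_comonad \<C> C c
    using assms(2) by (rule colocalization_idempotent_comonad)
  interpret monad \<C> T \<eta> \<mu> by fact
  interpret monad_idempotent_comonad \<C> C c T \<eta> \<mu> by unfold_locales
  have preserving: "colocal_preserving_monad \<C> C c T \<eta> \<mu>" if ?a
    using that by unfold_locales
  have a_b: "\<exists>s. (\<forall>(X, a) \<in> algebras \<C> T \<eta> \<mu>.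
                (fobj C X, s (X, a)) \<in> algebras \<C> T \<eta> \<mu> \<and>
                c X \<in> alg_hom \<C> T (fobj C X, s (X, a)) (X, a)) \<and>
             (\<forall>(X, a) \<in> algebras \<C> T \<eta> \<mu>. \<forall>(Y, b) \<in> algebras \<C> T \<eta> \<mu>.
                \<forall>g \<in> alg_hom \<C> T (X, a) (Y, b).
                  farr C g \<in> alg_hom \<C> T (fobj C X, s (X, a)) (fobj C Y, s (Y, b)))"
    (is "\<exists>s. ?b s") if ?a
  proof -
    interpret colocal_preserving_monad \<C> C c T \<eta> \<mu> using preserving that .
    have alg: "(fobj C X, lifted_structure (X, a)) = lifted_algebra (X, a)" for X a
      by (simp add: lifted_algebra_def)
    have "c X \<in> alg_hom \<C> T (lifted_algebra (X, a)) (X, a)" if "(X, a) \<in> algebras \<C> T \<eta> \<mu>" for X a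
      using counit_alg_hom [OF that] by simp
    then have "?b lifted_structure"
      unfolding alg using lifted_algebra C_alg_hom by blast
    then show ?thesis by (rule exI [of ?b])
  qed
  have b_a: ?a if "?b s" for s
    using preserves_colocal_T_if_lifts [of s] that by blast
  have a_c: "\<exists>CT cT. strict_lift \<C> T \<eta> \<mu> C c CT cT" if ?a
    using colocal_preserving_monad.strict_lift_lifted [OF preserving [OF that]] by blast
  have unique: "\<forall>(X, a) \<in> algebras \<C> T \<eta> \<mu>.
           \<exists>!a'. (fobj C X, a') \<in> algebras \<C> T \<eta> \<mu> \<and>
                c X \<in> alg_hom \<C> T (fobj C X, a') (X, a)" if ?a
  proof -
    interpret colocal_preserving_monad \<C> C c T \<eta> \<mu> using preserving that .
    have "\<exists>!a'. (fobj C X, a') \<in> algebras \<C> T \<eta> \<mu> \<and> c X \<in> alg_hom \<C> T (fobj C X, a') (X, a)"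
      if P: "(X, a) \<in> algebras \<C> T \<eta> \<mu>" for X a
    proof (rule ex1I)
      show "(fobj C X, lifted_structure (X, a)) \<in> algebras \<C> T \<eta> \<mu> \<and>
          c X \<in> alg_hom \<C> T (fobj C X, lifted_structure (X, a)) (X, a)"
        using lifted_algebra [OF P] counit_alg_hom [OF P] by (simp add: lifted_algebra_def)
      show "a' = lifted_structure (X, a)"
        if "(fobj C X, a') \<in> algebras \<C> T \<eta> \<mu> \<and> c X \<in> alg_hom \<C> T (fobj C X, a') (X, a)" for a'
        using lifted_algebra_unique [OF P] that by (simp add: lifted_algebra_def)
    qed
    then show ?thesis by blast
  qed
  have unique_lift: "functor_eq ?EM CT CT' \<and> trans_eq ?EM cT cT'"
    if ?a and lifts: "strict_lift \<C> T \<eta> \<mu> C c CT cT" "strict_lift \<C> T \<eta> \<mu> C c CT' cT'"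
    for CT cT CT' cT'
  proof -
    interpret colocal_preserving_monad \<C> C c T \<eta> \<mu> using preserving that(1) .
    show ?thesis
      using strict_lift_eq_lifted [OF lifts(1)] strict_lift_eq_lifted [OF lifts(2)]
      by (simp add: functor_eq_def trans_eq_def)
  qed
  have forget: "preserves_colocal ?EM cT \<C> c forget \<and> reflects_colocal ?EM cT \<C> c forget \<and>
      preserves_equivalences ?EM CT \<C> C forget \<and> reflects_equivalences ?EM CT \<C> C forget"
    if "strict_lift \<C> T \<eta> \<mu> C c CT cT \<or> iso_lift \<C> T \<eta> \<mu> C CT cT" for CT cT
  proof -
    \<comment> \<open>A strict lift is in particular a lift up to isomorphism, so both cases follow
      from the results for the latter.\<close>
    have "iso_lift \<C> T \<eta> \<mu> C CT cT" using that strict_lift_iso_lift by blast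
    from iso_lift_forget_colocal [OF this] iso_lift_forget_equivalence [OF this] show ?thesis
      by (simp add: preserves_colocal_def reflects_colocal_def preserves_equivalences_def
          reflects_equivalences_def)
  qed
  show ?thesis
  proof (intro conjI impI)
    show "?a \<longleftrightarrow> (\<exists>s. ?b s)" using a_b b_a by blast
    \<comment> \<open>This equivalence and the next come from one cycle: (a) yields a strict lift,
      which is a lift up to isomorphism, and any such lift yields (a).\<close>
    show "?a \<longleftrightarrow> (\<exists>CT cT. strict_lift \<C> T \<eta> \<mu> C c CT cT)"
      using a_c strict_lift_iso_lift preserves_colocal_T_if_iso_lift by blast
    show "?a \<longleftrightarrow> (\<exists>CT cT. iso_lift \<C> T \<eta> \<mu> C CT cT)"
      using a_c strict_lift_iso_lift preserves_colocal_T_if_iso_lift by blast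
  qed (use unique unique_lift forget in blast)+
qed

end
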